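(* Let $(a_k)_{k\ge 0}$ be complex numbers such that the series $\sum_{k=0}^\infty a_k \mathrm{w}(k,x)$ converges uniformly on $[0,1)$, let $$f(x) = \chi_{[0,1)}(x) \sum_{k=0}^{\infty} a_k \mathrm{w}(k,x), \qquad f_n(x) = \chi_{[0,1)}(x)\sum_{k=0}^{2^n-1} a_k \mathrm{w}(k,x) \quad (n\in\mathbb{N}),$$ and suppose $f \neq 0$, $V(f) < +\infty$ and $V(\widehat{f}) < +\infty$. Then $$UC_d(f) = \lim_{n\to\infty} V(f_n)\,V(\widehat{f}_n),$$ where, for every $n$ with $f_n\neq 0$ (hence for all sufficiently large $n$), $$V(f_n) = \frac{\min_{k_0 \in\{0,\dots,2^n-1\}} \sum_{k=0}^{2^n-1} |c_{k\oplus k_0}|^2\, \bigl((k+1)^3-k^3\bigr)\, 2^{-2n}/3}{\sum_{k=0}^{2^n-1} |a_k|^2},$$ $$V(\widehat{f}_n) = \frac{\min_{k_1 \in\{0,\dots,2^n-1\}} \sum_{k=0}^{2^n-1} |a_{k\oplus k_1}|^2\, \bigl((k+1)^3-k^3\bigr)/3}{\sum_{k=0}^{2^n-1} |c_k|^2},$$ and $c = (c_k)_{k=0}^{2^n-1}$ (depending on $n$) is the fast Walsh-Fourier transform of $a = (a_k)_{k=0}^{2^n-1}$.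
   Context: Notation: $\mathbb{R}_+ = [0,\infty)$; $\chi_M$ is the characteristic function of a set $M$. Every $x \in \mathbb{R}_+$ is written in its dyadic expansion $x = \sum_{j\in\mathbb{Z}} x_j 2^{-j-1}$ with $x_j \in \{0,1\}$; when two expansions exist (dyadic rationals), the one terminating in $0$'s is chosen, i.e. $x_j = 0$ for all large $j$. Dyadic sum: $x \oplus y := \sum_{j \in \mathbb{Z}} |x_j - y_j| 2^{-j-1}$ (on nonnegative integers this is bitwise XOR). Walsh functions and Walsh-Fourier transform: $\mathrm{w}(t,x) := (-1)^{\sum_{j\in\mathbb{Z}} t_j x_{-j-1}}$ for $t,x\in\mathbb{R}_+$; the Walsh functions are $\mathrm{w}(k,\cdot)$, $k=0,1,2,\dots$. For $g \in L_1(\mathbb{R}_+)$, $\widehat{g}(t) := \int_{\mathbb{R}_+} g(x)\,\mathrm{w}(t,x)\,dx$, extended to $L_2(\mathbb{R}_+)$ in the standard way by the Plancherel theorem. Fast Walsh-Fourier transform: for a row vector $a=(a_k)_{k=0}^{2^n-1}$ it is $c = a\mathrm{W}$, where $\mathrm{W} = 2^{-n/2}\bigl(\mathrm{w}(m,k/2^n)\bigr)_{k,m=0}^{2^n-1}$ is the normalized Walsh matrix (real, symmetric, orthogonal, $\mathrm{W}^{-1}=\mathrm{W}$). Dyadic uncertainty constant: for nonzero $g\in L_2(\mathbb{R}_+)$ let $$V(g) := \frac{1}{\|g\|^2_{L_2(\mathbb{R}_+)}} \min_{\tilde{x}\in\mathbb{R}_+} \int_{\mathbb{R}_+} (x \oplus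 \tilde{x})^2 |g(x)|^2\,dx,$$ with value $+\infty$ if all these integrals are infinite. Then $UC_d(g) := V(g)\,V(\widehat{g})$, where $V(\widehat g)$ is $V$ applied to $\widehat g$. *)

theory Defs
  imports "HOL-Analysis.Analysis"
begin

text \<open>
  Digit \<open>x\<^sub>j\<close> of \<open>x = (\<Sum>j. x\<^sub>j * 2 powi (-j-1))\<close>, for \<open>x \<ge> 0\<close>. The floor selects the expansion that
  terminates in zeros when there are two; see \<open>dyadic_digit_expansion\<close> and
  \<open>dyadic_digit_terminates\<close>.
\<close>

definition dyadic_digit :: "real \<Rightarrow> int \<Rightarrow> nat" where
  "dyadic_digit x j = nat (\<lfloor>x * 2 powi (j + 1)\<rfloor> mod 2)"

definition dyadic_sum :: "real \<Rightarrow> real \<Rightarrow> real" where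
  "dyadic_sum x y =
     (\<Sum>\<^sub>\<infinity>j::int. \<bar>real (dyadic_digit x j) - real (dyadic_digit y j)\<bar> * 2 powi (- j - 1))"

text \<open>For \<open>t, x \<ge> 0\<close> only finitely many terms of the exponent are nonzero; the sum is restricted to
  them because \<^const>\<open>sum\<close> vanishes on infinite sets.\<close>

definition walsh :: "real \<Rightarrow> real \<Rightarrow> real" where
  "walsh t x =
     (- 1) ^ (\<Sum>j | dyadic_digit t j * dyadic_digit x (- j - 1) \<noteq> 0.
                 dyadic_digit t j * dyadic_digit x (- j - 1))"

abbreviation Rplus :: "real measure" where
  "Rplus \<equiv> lebesgue_on {0..}"

definition sq_norm :: "(real \<Rightarrow> complex) \<Rightarrow> ennreal" where
  "sq_norm g = (\<integral>\<^sup>+ x. ennreal ((cmod (g x))\<^sup>2) \<partial>Rplus)"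

definition walsh_integral :: "(real \<Rightarrow> complex) \<Rightarrow> real \<Rightarrow> complex" where
  "walsh_integral g t = (LINT x|Rplus. g x * complex_of_real (walsh t x))"

text \<open>The integral on \<open>L\<^sub>1\<close>; otherwise, for \<open>g\<close> in \<open>L\<^sub>2\<close>, the \<open>L\<^sub>2\<close>-limit of the transforms of the
  truncations of \<open>g\<close> to \<open>[0,N)\<close>, which exists by Plancherel and is unique almost everywhere.\<close>

definition walsh_transform :: "(real \<Rightarrow> complex) \<Rightarrow> real \<Rightarrow> complex" where
  "walsh_transform g =
     (if integrable Rplus g then walsh_integral g
      else (SOME h. h \<in> borel_measurable Rplus \<and> sq_norm h < \<infinity> \<and>
              (\<lambda>N::nat. sq_norm (\<lambda>t. h t - walsh_integral (\<lambda>x. indicator {0..<real N} x * g x) t))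
                \<longlonglongrightarrow> 0))"

text \<open>The infimum is taken in the extended nonnegative reals, so it is \<open>\<infinity>\<close> when all the integrals
  are, and it is the minimum whenever a minimum is attained. It need not be attained for every
  \<open>g\<close>, because \<open>[0,\<infinity>)\<close> lacks the limit points whose digits are eventually \<open>1\<close>.\<close>

definition V :: "(real \<Rightarrow> complex) \<Rightarrow> ennreal" where
  "V g = (INF xt\<in>{0..}. \<integral>\<^sup>+ x. ennreal ((dyadic_sum x xt)\<^sup>2 * (cmod (g x))\<^sup>2) \<partial>Rplus) / sq_norm g"

definition UC_d :: "(real \<Rightarrow> complex) \<Rightarrow> ennreal" where
  "UC_d g = V g * V (walsh_transform g)"

definition walsh_matrix :: "nat \<Rightarrow> nat \<Rightarrow> nat \<Rightarrow> real" where
  "walsh_matrix n k m = 2 powr (- real n / 2) * walsh (real m) (real k / 2 ^ n)"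

text \<open>Row vector times matrix; only the entries with index below \<open>2 ^ n\<close> are meaningful.\<close>

definition fast_walsh_transform :: "nat \<Rightarrow> (nat \<Rightarrow> complex) \<Rightarrow> nat \<Rightarrow> complex" where
  "fast_walsh_transform n a m = (\<Sum>k<2 ^ n. a k * complex_of_real (walsh_matrix n k m))"


subsection \<open>The digits give the dyadic expansion terminating in zeros\<close>

lemma dyadic_digit_le_1: "dyadic_digit x j \<le> 1"
  unfolding dyadic_digit_def by auto

lemma real_dyadic_digit:
  "real (dyadic_digit x j) = real_of_int \<lfloor>x * 2 powi (j + 1)\<rfloor> - 2 * real_of_int \<lfloor>x * 2 powi j\<rfloor>"
proof -
  define y where "y = x * 2 powi j"
  have y: "x * 2 powi (j + 1) = 2 * y" unfolding y_def by (simp add: power_int_add)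
  have "\<lfloor>2 * y\<rfloor> div 2 = \<lfloor>y\<rfloor>"
    using floor_divide_real_eq_div[of 2 "2 * y"] by simp
  then have "\<lfloor>2 * y\<rfloor> mod 2 = \<lfloor>2 * y\<rfloor> - 2 * \<lfloor>y\<rfloor>"
    by (simp add: minus_mult_div_eq_mod[symmetric])
  moreover have "real (dyadic_digit x j) = real_of_int (\<lfloor>2 * y\<rfloor> mod 2)"
    unfolding dyadic_digit_def y by simp
  ultimately show ?thesis unfolding y y_def[symmetric] by simp
qed

lemma dyadic_digit_eq_0_low:
  assumes "x \<ge> 0" "x * 2 powi (j + 1) < 1"
  shows "dyadic_digit x j = 0"
proof -
  have "\<lfloor>x * 2 powi (j + 1)\<rfloor> = 0" using assms by (simp add: floor_eq_iff)
  then show ?thesis by (simp add: dyadic_digit_def)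
qed

lemma dyadic_digit_partial_sum:
  assumes "x \<ge> 0" "x * 2 powi i < 1"
  shows "(\<Sum>k<n. real (dyadic_digit x (i + int k)) * 2 powi (- (i + int k) - 1))
           = real_of_int \<lfloor>x * 2 powi (i + int n)\<rfloor> * 2 powi (- (i + int n))"
proof (induction n)
  case 0
  have "\<lfloor>x * 2 powi i\<rfloor> = 0" using assms by (simp add: floor_eq_iff)
  then show ?case by simp
next
  case (Suc n)
  have p: "2 * (2::real) powi (- (i + int n) - 1) = 2 powi (- (i + int n))"
    by (simp add: power_int_diff)
  have q: "- (i + int n) - 1 = - (i + int (Suc n))" "i + int n + 1 = i + int (Suc n)" by auto
  have "(\<Sum>k<Suc n. real (dyadic_digit x (i + int k)) * 2 powi (- (i + int k) - 1))
      = real_of_int \<lfloor>x * 2 powi (i + int n)\<rfloor> * 2 powi (- (i + int n))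
        + real (dyadic_digit x (i + int n)) * 2 powi (- (i + int n) - 1)"
    using Suc by simp
  also have "\<dots> = real_of_int \<lfloor>x * 2 powi (i + int n + 1)\<rfloor> * 2 powi (- (i + int n) - 1)"
    unfolding real_dyadic_digit p[symmetric] by (simp add: algebra_simps)
  finally show ?case unfolding q by simp
qed

theorem dyadic_digit_expansion:
  assumes "x \<ge> 0"
  shows "((\<lambda>j::int. real (dyadic_digit x j) * 2 powi (- j - 1)) has_sum x) UNIV"
proof -
  obtain m :: nat where m: "x < 2 ^ m" using real_arch_pow[of 2 x] by auto
  define i where "i = - int m"
  have mi: "x * 2 powi i < 1"
    using m by (simp add: i_def power_int_minus field_simps)
  define g where "g = (\<lambda>k::nat. real (dyadic_digit x (i + int k)) * 2 powi (- (i + int k) - 1))"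
  have part: "sum g {..<n} = real_of_int \<lfloor>x * 2 powi (i + int n)\<rfloor> * 2 powi (- (i + int n))" for n
    unfolding g_def by (rule dyadic_digit_partial_sum[OF assms mi])
  have canc: "(2::real) powi z * 2 powi (- z) = 1" for z :: int
    by (simp add: power_int_minus)
  have up: "sum g {..<n} \<le> x" for n
  proof -
    have "real_of_int \<lfloor>x * 2 powi (i + int n)\<rfloor> * 2 powi (- (i + int n))
        \<le> (x * 2 powi (i + int n)) * 2 powi (- (i + int n))"
      by (intro mult_right_mono) auto
    also have "\<dots> = x" using canc[of "i + int n"] by (simp add: mult.assoc)
    finally show ?thesis using part by simp
  qed
  have lo: "x - 2 powi (- (i + int n)) \<le> sum g {..<n}" for n
  proof -
    have "(x * 2 powi (i + int n) - 1) * 2 powi (- (i + int n))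
        \<le> real_of_int \<lfloor>x * 2 powi (i + int n)\<rfloor> * 2 powi (- (i + int n))"
    proof (rule mult_right_mono)
      show "x * 2 powi (i + int n) - 1 \<le> real_of_int \<lfloor>x * 2 powi (i + int n)\<rfloor>" by linarith
    qed simp
    moreover have "(x * 2 powi (i + int n) - 1) * 2 powi (- (i + int n))
        = x - 2 powi (- (i + int n))"
      using canc[of "i + int n"] by (simp add: left_diff_distrib mult.assoc)
    ultimately show ?thesis unfolding part by linarith
  qed
  have "(\<lambda>n. (2::real) powi (- (i + int n))) = (\<lambda>n. 2 powi (- i) * (1 / 2) ^ n)"
    by (auto simp: fun_eq_iff power_int_add power_int_minus power_int_diff divide_simps)
  moreover have "(\<lambda>n. (2::real) powi (- i) * (1 / 2) ^ n) \<longlonglongrightarrow> 2 powi (- i) * 0"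
    by (intro tendsto_mult tendsto_const LIMSEQ_power_zero) auto
  ultimately have "(\<lambda>n. x - (2::real) powi (- (i + int n))) \<longlonglongrightarrow> x - 0"
    by (intro tendsto_diff tendsto_const) simp
  then have "(\<lambda>n. sum g {..<n}) \<longlonglongrightarrow> x"
    using tendsto_sandwich[of "\<lambda>n. x - 2 powi (- (i + int n))" "\<lambda>n. sum g {..<n}" sequentially
        "\<lambda>_. x" x] up lo by simp
  then have "g sums x" by (simp add: sums_def)
  moreover have "g k \<ge> 0" for k by (simp add: g_def)
  ultimately have "(g has_sum x) UNIV" by (intro sums_nonneg_imp_has_sum) auto
  moreover have "inj (\<lambda>k::nat. i + int k)" by (auto simp: inj_def)
  ultimately have "((\<lambda>j::int. real (dyadic_digit x j) * 2 powi (- j - 1)) has_sum x)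
      (range (\<lambda>k::nat. i + int k))"
    by (subst has_sum_reindex) (auto simp: g_def o_def)
  moreover have "dyadic_digit x j = 0" if "j \<notin> range (\<lambda>k::nat. i + int k)" for j
  proof -
    have "j < i"
    proof (rule ccontr)
      assume "\<not> j < i"
      then have "j = i + int (nat (j - i))" by simp
      then show False using that by blast
    qed
    then have "(2::real) powi (j + 1) \<le> 2 powi i" by (intro power_int_increasing) auto
    then have "x * 2 powi (j + 1) < 1" using mi mult_left_mono[OF _ assms] by fastforce
    then show ?thesis by (rule dyadic_digit_eq_0_low[OF assms])
  qed
  ultimately show ?thesis
    by (subst has_sum_cong_neutral[where S = "range (\<lambda>k::nat. i + int k)" and T = UNIV
          and g = "\<lambda>j::int. real (dyadic_digit x j) * 2 powi (- j - 1)", symmetric]) auto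
qed

theorem dyadic_digit_terminates:
  assumes "x = real p / 2 ^ q" "j \<ge> int q"
  shows "dyadic_digit x j = 0"
proof -
  have e: "j + 1 = int q + int (Suc (nat (j - int q)))" using assms(2) by simp
  have "x * 2 powi (j + 1) = real (p * 2 ^ Suc (nat (j - int q)))"
    unfolding assms(1) e by (subst power_int_add) (auto simp: power_int_def nat_add_distrib)
  then have "\<lfloor>x * 2 powi (j + 1)\<rfloor> = int (p * 2 ^ Suc (nat (j - int q)))"
    by (metis floor_of_nat)
  then show ?thesis by (simp add: dyadic_digit_def)
qed

text \<open>On natural numbers the dyadic sum is bitwise exclusive or.\<close>

lemma dyadic_digit_of_nat:
  "dyadic_digit (real k) j = (if j < 0 then of_bool (bit k (nat (- j - 1))) else 0)"
proof (cases "j < 0")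
  case True
  define b where "b = nat (- j - 1)"
  have "j + 1 = - int b" using True by (simp add: b_def)
  then have "real k * 2 powi (j + 1) = real k / real (2 ^ b)"
    by (simp add: power_int_minus field_simps)
  then have "\<lfloor>real k * 2 powi (j + 1)\<rfloor> = int (k div 2 ^ b)"
    using floor_divide_of_nat_eq[of k "2 ^ b"] by (metis)
  then have "dyadic_digit (real k) j = nat (int (k div 2 ^ b mod 2))"
    by (simp only: dyadic_digit_def zmod_int of_nat_numeral)
  also have "\<dots> = of_bool (bit k b)"
    by (simp add: bit_iff_odd odd_iff_mod_2_eq_one del: One_nat_def)
  finally show ?thesis using True by (simp add: b_def)
next
  case False
  then show ?thesis using dyadic_digit_terminates[of "real k" k 0 j] by simp
qed

lemma dyadic_sum_of_nat: "dyadic_sum (real k) (real m) = real (xor k m)"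
proof -
  have "\<bar>real (dyadic_digit (real k) j) - real (dyadic_digit (real m) j)\<bar>
      = real (dyadic_digit (real (xor k m)) j)" for j
    by (simp add: dyadic_digit_of_nat bit_xor_iff)
  then show ?thesis
    unfolding dyadic_sum_def using dyadic_digit_expansion[of "real (xor k m)"]
    by (simp add: infsumI)
qed

end

theory Submission
  imports Defs
begin

text \<open>
  The partial sum \<open>f\<^sub>n\<close> is constant on the dyadic cells of level \<open>n\<close>, with values \<open>2 ^ (n/2) * c\<^sub>k\<close>, and its
  transform is constant on the unit cells, with values \<open>a\<^sub>k\<close>. Translating a cell by \<open>y\<close> in the dyadic
  sum gives the cell whose index is changed by exclusive or with the index of \<open>y\<close>. So the second
  moment of a step function is a finite sum that depends only on the index of \<open>y\<close>, and indices
  \<open>\<ge> 2 ^ n\<close> can be reduced modulo \<open>2 ^ n\<close> without increasing it. Orthogonality of the Walsh functions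
  gives the norms.

  \<open>V f\<^sub>n\<close> converges to \<open>V f\<close> because \<open>f\<^sub>n\<close> converges uniformly on \<open>[0,1)\<close>. On the transform side the moments
  about each \<open>y\<close> increase to those of the transform of \<open>f\<close>.
\<close>

subsection \<open>Dyadic cells and the dyadic sum\<close>

text \<open>The two sides need different limit arguments. On \<open>[0,1)\<close> the weight is
  bounded, so closeness of the functions gives closeness of the moments about all \<open>y\<close>
  at once, and hence of their infima. On the transform side the weight is unbounded and only
  monotone convergence is available; an increasing limit need not commute with an infimum, and the
  growth of the moments in \<open>y\<close> has to supply the missing compactness.

  The factor \<open>((k+1)^3 - k^3)/3\<close> is the integral of the squared variable over a unit
  cell. On cells of length \<open>2^(-n)\<close> it is scaled by \<open>8^(-n)\<close>; squared cell
  values are \<open>2^n\<close> times those of \<open>c\<close>, which leaves the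
  \<open>2^(-2n)\<close> of the formula for \<open>f\<close>. On the transform side cells have
  length 1 and nothing is scaled.

  The transform of \<open>f\<close> is found explicitly: it takes the value of the
  \<open>k\<close>-th coefficient on the \<open>k\<close>-th unit cell. Its norm equals that of
  \<open>f\<close> because both are limits of the same finite sums of squared coefficients.\<close>

definition dyadic_index :: "nat \<Rightarrow> real \<Rightarrow> nat" where
  "dyadic_index n x = nat \<lfloor>x * 2 ^ n\<rfloor>"

definition dyadic_cell :: "nat \<Rightarrow> nat \<Rightarrow> real set" where
  "dyadic_cell n k = {real k / 2 ^ n ..< (real k + 1) / 2 ^ n}"

text \<open>The condition \<open>0 \<le> x\<close> cannot be dropped: \<open>nat\<close> sends a
  negative floor to \<open>0\<close>, so negative numbers also have index \<open>0\<close>.\<close>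

lemma mem_dyadic_cell_iff: "x \<in> dyadic_cell n k \<longleftrightarrow> 0 \<le> x \<and> dyadic_index n x = k"
proof -
  have "x \<in> dyadic_cell n k \<longleftrightarrow> real k \<le> x * 2 ^ n \<and> x * 2 ^ n < real k + 1"
    by (auto simp: dyadic_cell_def field_simps)
  also have "\<dots> \<longleftrightarrow> \<lfloor>x * 2 ^ n\<rfloor> = int k"
    by (simp add: floor_eq_iff)
  also have "\<dots> \<longleftrightarrow> 0 \<le> x \<and> dyadic_index n x = k"
  proof
    assume h: "\<lfloor>x * 2 ^ n\<rfloor> = int k"
    then have "0 \<le> \<lfloor>x * 2 ^ n\<rfloor>" by simp
    then have "0 \<le> x * 2 ^ n" by (simp only: zero_le_floor)
    then have "0 \<le> x" by (metis zero_le_mult_iff zero_less_numeral zero_less_power not_le)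
    with h show "0 \<le> x \<and> dyadic_index n x = k" by (simp add: dyadic_index_def)
  next
    assume "0 \<le> x \<and> dyadic_index n x = k"
    then show "\<lfloor>x * 2 ^ n\<rfloor> = int k" by (auto simp: dyadic_index_def)
  qed
  finally show ?thesis .
qed

lemma dyadic_cell_measurable [measurable, simp]: "dyadic_cell n k \<in> sets borel"
  by (simp add: dyadic_cell_def)

lemma emeasure_dyadic_cell: "emeasure lborel (dyadic_cell n k) = ennreal (1 / 2 ^ n)"
  by (simp add: dyadic_cell_def divide_right_mono diff_divide_distrib[symmetric])

lemma dyadic_index_divide_power [simp]: "dyadic_index n (real k / 2 ^ n) = k"
  by (simp add: dyadic_index_def)

lemma dyadic_index_0_of_nat [simp]: "dyadic_index 0 (real k) = k"
  by (simp add: dyadic_index_def)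

lemma dyadic_index_div: 
  assumes "0 \<le> x"
  shows "dyadic_index n x = dyadic_index (n + N) x div 2 ^ N"
proof -
  have "x * 2 ^ n = (x * 2 ^ (n + N)) / real_of_int (2 ^ N)"
    by (simp add: power_add)
  then have "\<lfloor>x * 2 ^ n\<rfloor> = \<lfloor>x * 2 ^ (n + N)\<rfloor> div 2 ^ N"
    by (metis floor_divide_real_eq_div zero_le_numeral zero_le_power)
  then show ?thesis
    using assms by (simp add: dyadic_index_def nat_div_distrib nat_power_eq)
qed

lemma dyadic_index_less: "x < 1 \<Longrightarrow> dyadic_index n x < 2 ^ n"
  by (simp add: dyadic_index_def nat_less_iff floor_less_iff)

text \<open>Dropping the integer part of \<open>x\<close> changes \<open>x * 2 ^ n\<close> by a
  multiple of \<open>2 ^ n\<close>, so it clears the bits from position \<open>n\<close> on and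
  keeps the others.\<close>

lemma dyadic_index_frac:
  assumes "0 \<le> x"
  shows "dyadic_index n (frac x) = dyadic_index n x mod 2 ^ n"
proof -
  have e: "x * 2 ^ n = frac x * 2 ^ n + real_of_int (\<lfloor>x\<rfloor> * 2 ^ n)"
    by (simp add: frac_def algebra_simps)
  have "\<lfloor>x * 2 ^ n\<rfloor> = \<lfloor>frac x * 2 ^ n\<rfloor> + \<lfloor>x\<rfloor> * 2 ^ n"
    unfolding e floor_add_int by (rule refl)
  then have "dyadic_index n x = dyadic_index n (frac x) + nat \<lfloor>x\<rfloor> * 2 ^ n"
    using assms by (simp add: dyadic_index_def nat_add_distrib nat_mult_distrib nat_power_eq)
  moreover have "dyadic_index n (frac x) < 2 ^ n"
    by (rule dyadic_index_less) (rule frac_lt_1)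
  ultimately show ?thesis by simp
qed

text \<open>Digit \<open>j\<close> has weight \<open>2 powi (-j-1)\<close>, so in the integer part
  of \<open>x * 2 ^ n\<close> it becomes bit \<open>n - 1 - j\<close>. This reversal is why the
  Walsh exponent later pairs bit \<open>i\<close> with bit \<open>n - 1 - i\<close>.\<close>

lemma dyadic_digit_eq_bit:
  assumes "0 \<le> x" "j < int n"
  shows "dyadic_digit x j = of_bool (bit (dyadic_index n x) (nat (int n - 1 - j)))"
proof -
  define b where "b = nat (int n - 1 - j)"
  have b: "j + 1 = int n - int b" using assms by (simp add: b_def)
  have "x * 2 powi (j + 1) = (x * 2 ^ n) / real_of_int (2 ^ b)"
    unfolding b by (simp add: power_int_diff)
  then have "\<lfloor>x * 2 powi (j + 1)\<rfloor> = \<lfloor>x * 2 ^ n\<rfloor> div 2 ^ b"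
    by (metis floor_divide_real_eq_div zero_le_numeral zero_le_power)
  then have "dyadic_digit x j = nat (\<lfloor>x * 2 ^ n\<rfloor> div 2 ^ b mod 2)"
    by (simp add: dyadic_digit_def)
  also have "\<dots> = dyadic_index n x div 2 ^ b mod 2"
    using assms by (simp add: dyadic_index_def nat_div_distrib nat_mod_distrib nat_power_eq 
        pos_imp_zdiv_nonneg_iff)
  also have "\<dots> = of_bool (bit (dyadic_index n x) b)"
    by (simp add: bit_iff_odd odd_iff_mod_2_eq_one)
  finally show ?thesis by (simp add: b_def)
qed

lemma has_sum_dyadic_tail:
  "((\<lambda>j::int. (2::real) powi (- j - 1)) has_sum (1 / 2 ^ n)) {int n..}"
proof -
  have "(\<lambda>k. (1 / 2) ^ k * ((1::real) / 2 ^ Suc n)) sums (1 / (1 - 1 / 2) * (1 / 2 ^ Suc n))"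
    by (intro sums_mult2 geometric_sums) simp
  then have "((\<lambda>k. (1 / 2) ^ k * ((1::real) / 2 ^ Suc n)) has_sum (1 / 2 ^ n)) UNIV"
    by (intro sums_nonneg_imp_has_sum) (simp_all add: field_simps)
  moreover have "(1 / 2) ^ k * ((1::real) / 2 ^ Suc n) = 2 powi (- (int n + int k) - 1)" for k
    by (simp add: power_int_diff power_int_minus power_int_add field_simps)
  ultimately have *: "((\<lambda>k::nat. (2::real) powi (- (int n + int k) - 1)) has_sum (1 / 2 ^ n)) UNIV"
    by simp
  have "(\<lambda>k. int n + int k) ` UNIV = {int n..}"
  proof (intro set_eqI iffI)
    fix j assume "j \<in> {int n..}"
    then have "j = int n + int (nat (j - int n))" by simp
    then show "j \<in> range (\<lambda>k. int n + int k)" by blast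
  qed auto
  moreover have "inj (\<lambda>k. int n + int k)" by (auto simp: inj_def)
  ultimately show ?thesis
    using * has_sum_reindex[of "\<lambda>k. int n + int k" UNIV "\<lambda>j. (2::real) powi (- j - 1)" "1 / 2 ^ n"]
    by (simp add: o_def)
qed

text \<open>The terms at positions below \<open>n\<close> are the digits of
  \<open>m / 2 ^ n\<close>; the remaining ones lie between zero and a geometric tail of sum
  \<open>1 / 2 ^ n\<close>. The upper bound is not strict, since the tail may consist of ones only:
  2/3 and 1/3 have complementary digits and dyadic sum 1.\<close>

lemma dyadic_sum_bounds:
  fixes x y :: real and n :: nat
  assumes "0 \<le> x" "0 \<le> y"
  defines "m \<equiv> xor (dyadic_index n x) (dyadic_index n y)"
  shows "real m / 2 ^ n \<le> dyadic_sum x y" "dyadic_sum x y \<le> (real m + 1) / 2 ^ n"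
proof -
  define d where "d = (\<lambda>j::int. \<bar>real (dyadic_digit x j) - real (dyadic_digit y j)\<bar> * 2 powi (- j - 1))"
  define z where "z = real m / 2 ^ n"
  have d0: "0 \<le> d j" for j by (simp add: d_def)
  have dz: "real (dyadic_digit z j) * 2 powi (- j - 1) = d j" if "j < int n" for j
    using that assms(1,2)
    by (simp add: dyadic_digit_eq_bit[where n = n] d_def z_def m_def bit_xor_iff)
  have d1: "d j \<le> 2 powi (- j - 1)" for j
    using dyadic_digit_le_1[of x j] dyadic_digit_le_1[of y j]
    by (auto simp: d_def intro!: mult_left_le_one_le)
  have z0: "dyadic_digit z j = 0" if "j \<ge> int n" for j
    using that by (intro dyadic_digit_terminates[of z m n]) (auto simp: z_def)
  have "((\<lambda>j. real (dyadic_digit z j) * 2 powi (- j - 1)) has_sum z) UNIV"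
    by (rule dyadic_digit_expansion) (simp add: z_def)
  then have lo: "(d has_sum z) {..<int n}"
    by (subst has_sum_cong_neutral[where T = UNIV
          and g = "\<lambda>j::int. real (dyadic_digit z j) * 2 powi (- j - 1)"]) (auto simp: z0 dz)
  have "(\<lambda>j. norm (d j)) summable_on {int n..}"
  proof (rule Infinite_Sum.abs_summable_on_comparison_test)
    show "(\<lambda>j. norm ((2::real) powi (- j - 1))) summable_on {int n..}"
      using has_sum_imp_summable[OF has_sum_dyadic_tail[of n]] by simp
  qed (use d0 d1 in simp)
  then have "d summable_on {int n..}" by (rule Infinite_Sum.abs_summable_summable)
  then obtain s where s: "(d has_sum s) {int n..}" by (auto simp: summable_on_def)
  have s0: "0 \<le> s" by (rule has_sum_nonneg[OF s]) (use d0 in auto)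
  have s1: "s \<le> 1 / 2 ^ n" by (rule has_sum_mono[OF s has_sum_dyadic_tail]) (use d1 in auto)
  have "(d has_sum (z + s)) ({..<int n} \<union> {int n..})"
    by (rule has_sum_Un_disjoint[OF lo s]) auto
  moreover have "{..<int n} \<union> {int n..} = UNIV" by auto
  ultimately have "dyadic_sum x y = z + s"
    unfolding dyadic_sum_def d_def[symmetric] by (simp add: infsumI)
  then show "real m / 2 ^ n \<le> dyadic_sum x y" "dyadic_sum x y \<le> (real m + 1) / 2 ^ n"
    using s0 s1 by (auto simp: z_def add_divide_distrib)
qed

lemma dyadic_sum_nonneg: "0 \<le> x \<Longrightarrow> 0 \<le> y \<Longrightarrow> 0 \<le> dyadic_sum x y"
  using dyadic_sum_bounds(1)[of x y 0] by (metis divide_nonneg_nonneg of_nat_0_le_iff order_trans zero_le_numeral zero_le_power)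

text \<open>Serves to carry inequalities between exclusive ors over to dyadic sums, and to obtain
  measurability.\<close>

lemma dyadic_sum_limit:
  assumes "0 \<le> x" "0 \<le> y"
  shows "(\<lambda>n. real (xor (dyadic_index n x) (dyadic_index n y)) / 2 ^ n) \<longlonglongrightarrow> dyadic_sum x y"
proof -
  have "(\<lambda>n. (1::real) / 2 ^ n) = (\<lambda>n. (1 / 2) ^ n)" by (simp add: power_divide)
  moreover have "(\<lambda>n. (1 / 2 :: real) ^ n) \<longlonglongrightarrow> 0" by (rule LIMSEQ_power_zero) simp
  ultimately have "(\<lambda>n. dyadic_sum x y - 1 / 2 ^ n) \<longlonglongrightarrow> dyadic_sum x y - 0"
    by (intro tendsto_diff tendsto_const) simp
  then have lim: "(\<lambda>n. dyadic_sum x y - 1 / 2 ^ n) \<longlonglongrightarrow> dyadic_sum x y" by simp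
  show ?thesis
  proof (rule tendsto_sandwich[OF _ _ lim tendsto_const])
    show "\<forall>\<^sub>F n in sequentially. dyadic_sum x y - 1 / 2 ^ n
        \<le> real (xor (dyadic_index n x) (dyadic_index n y)) / 2 ^ n"
    proof (rule always_eventually, rule allI)
      fix n
      show "dyadic_sum x y - 1 / 2 ^ n \<le> real (xor (dyadic_index n x) (dyadic_index n y)) / 2 ^ n"
        using dyadic_sum_bounds(2)[OF assms, of n] unfolding add_divide_distrib by linarith
    qed
    show "\<forall>\<^sub>F n in sequentially. real (xor (dyadic_index n x) (dyadic_index n y)) / 2 ^ n
        \<le> dyadic_sum x y"
      by (rule always_eventually, rule allI) (rule dyadic_sum_bounds(1)[OF assms])
  qed
qed

text \<open>The number \<open>k\<close> has no bits from position \<open>n\<close> on, so the high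
  bits of \<open>q\<close> survive in \<open>xor k q\<close>; reducing \<open>q\<close> only removes
  them.\<close>

lemma xor_mod_power_le:
  fixes k q :: nat
  assumes "k < 2 ^ n"
  shows "xor k (q mod 2 ^ n) \<le> xor k q"
proof -
  have "xor k (q mod 2 ^ n) = take_bit n (xor k q)"
    using assms by (simp add: take_bit_xor take_bit_nat_eq_self flip: take_bit_eq_mod)
  also have "\<dots> \<le> xor k q" by (simp add: take_bit_eq_mod)
  finally show ?thesis .
qed

lemma xor_less_power:
  fixes k q :: nat
  assumes "k < 2 ^ n" "q < 2 ^ n"
  shows "xor k q < 2 ^ n"
proof -
  have "take_bit n (xor k q) = xor k q"
    using assms by (simp add: take_bit_nat_eq_self)
  then show ?thesis using take_bit_nat_less_exp[of n "xor k q"] by simp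
qed

lemma bij_betw_xor:
  fixes q :: nat
  assumes "q < 2 ^ n"
  shows "bij_betw (\<lambda>k. xor k q) {..<2 ^ n} {..<2 ^ n}"
  by (rule bij_betwI[where g = "\<lambda>k. xor k q"])
     (use assms in \<open>auto simp: xor_less_power xor.assoc\<close>)

lemma dyadic_sum_frac_le:
  assumes "0 \<le> x" "x < 1" "0 \<le> y"
  shows "dyadic_sum x (frac y) \<le> dyadic_sum x y"
proof (rule LIMSEQ_le[OF dyadic_sum_limit dyadic_sum_limit])
  show "\<exists>N. \<forall>n\<ge>N. real (xor (dyadic_index n x) (dyadic_index n (frac y))) / 2 ^ n
      \<le> real (xor (dyadic_index n x) (dyadic_index n y)) / 2 ^ n"
    using assms by (auto simp: dyadic_index_frac intro!: divide_right_mono xor_mod_power_le dyadic_index_less)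
qed (use assms in auto)

text \<open>At level \<open>0\<close> both indices vanish, and only the tail is left. Equality can
  occur, so the sum may leave \<open>[0,1)\<close>.\<close>

lemma dyadic_sum_le_1:
  assumes "0 \<le> x" "x < 1" "0 \<le> y" "y < 1"
  shows "dyadic_sum x y \<le> 1"
proof -
  have "dyadic_index 0 x = 0" "dyadic_index 0 y = 0"
    using dyadic_index_less[of x 0] dyadic_index_less[of y 0] assms by auto
  then show ?thesis using dyadic_sum_bounds(2)[of x y 0] assms by simp
qed

lemma dyadic_index_measurable [measurable]: "dyadic_index n \<in> borel \<rightarrow>\<^sub>M count_space UNIV"
  unfolding dyadic_index_def by measurable

text \<open>A pointwise limit of functions of the index, but only for nonnegative arguments; the
  indicator discards the others.\<close>

lemma dyadic_sum_measurable:
  assumes "0 \<le> y"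
  shows "(\<lambda>x. indicator {0..} x * dyadic_sum x y) \<in> borel_measurable borel"
proof (rule borel_measurable_LIMSEQ_real)
  show "(\<lambda>x. indicator {0..} x * (real (xor (dyadic_index n x) (dyadic_index n y)) / 2 ^ n))
      \<in> borel_measurable borel" for n
    by measurable
  show "(\<lambda>n. indicator {0..} x * (real (xor (dyadic_index n x) (dyadic_index n y)) / 2 ^ n))
      \<longlonglongrightarrow> indicator {0..} x * dyadic_sum x y" for x
    using dyadic_sum_limit[of x y] assms by (auto simp: indicator_def)
qed

subsection \<open>Moments of dyadic step functions\<close>

text \<open>Both arguments are concatenations of a high block and a low block of \<open>N\<close>
  bits, and exclusive or acts on the blocks separately.\<close>

lemma mult_power_xor:
  fixes k p i r :: nat
  assumes "i < 2 ^ N" "r < 2 ^ N"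
  shows "xor (k * 2 ^ N + i) (p * 2 ^ N + r) = xor k p * 2 ^ N + xor i r"
proof -
  let ?z = "xor (k * 2 ^ N + i) (p * 2 ^ N + r)"
  have "?z = ?z div 2 ^ N * 2 ^ N + ?z mod 2 ^ N" by (simp only: div_mult_mod_eq)
  also have "?z div 2 ^ N = xor k p"
    using assms by (simp add: drop_bit_xor flip: drop_bit_eq_div) (simp add: drop_bit_eq_div)
  also have "?z mod 2 ^ N = xor i r"
    using assms by (simp add: take_bit_xor flip: take_bit_eq_mod) (simp add: take_bit_eq_mod)
  finally show ?thesis .
qed

text \<open>The integral of \<open>x\<^sup>2\<close> over \<open>[k, k + 1]\<close>.\<close>

definition cube_step :: "nat \<Rightarrow> real" where
  "cube_step k = ((real k + 1) ^ 3 - real k ^ 3) / 3"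

lemma cube_step_eq: "cube_step k = (real k)\<^sup>2 + real k + 1 / 3"
  by (simp add: cube_step_def power3_eq_cube power2_eq_square field_simps)

lemma cube_step_ge: "(real k)\<^sup>2 \<le> cube_step k"
  by (simp add: cube_step_eq)

lemma cube_step_le: "cube_step k \<le> (real k + 1)\<^sup>2"
  by (simp add: cube_step_eq power2_eq_square field_simps)

lemma cube_step_nonneg: "0 \<le> cube_step k"
  by (simp add: cube_step_eq)

lemma cube_step_mono: "k \<le> l \<Longrightarrow> cube_step k \<le> cube_step l"
  by (auto simp: cube_step_eq intro!: add_mono power_mono)

text \<open>The unit steps inside a block of length \<open>2 ^ N\<close> telescope;
  \<open>8 ^ N\<close> is the scaling of the integral of a square when lengths grow by
  \<open>2 ^ N\<close>.\<close>

lemma sum_cube_step_block: "(\<Sum>i<2 ^ N. cube_step (j * 2 ^ N + i)) = cube_step j * 8 ^ N"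
proof -
  define F where "F i = (real (j * 2 ^ N + i)) ^ 3 / 3" for i
  have "(\<Sum>i<2 ^ N. cube_step (j * 2 ^ N + i)) = (\<Sum>i<2 ^ N. F (Suc i) - F i)"
    by (intro sum.cong refl) (simp add: cube_step_def F_def algebra_simps diff_divide_distrib)
  also have "\<dots> = F (2 ^ N) - F 0" by (rule sum_lessThan_telescope)
  also have "\<dots> = (((real j + 1) * 2 ^ N) ^ 3 - (real j * 2 ^ N) ^ 3) / 3"
    by (simp add: F_def algebra_simps diff_divide_distrib)
  also have "\<dots> = cube_step j * (2 ^ N) ^ 3"
    unfolding cube_step_def power_mult_distrib by (simp add: algebra_simps)
  also have "(2 ^ N :: real) ^ 3 = 8 ^ N"
    by (simp flip: power_mult add: mult.commute[of N]) (simp add: power_mult)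
  finally show ?thesis .
qed

text \<open>Telescopes to the gap between upper and lower Riemann sums of the square over a block.
  Compared with the scale \<open>8 ^ N\<close> of the integral it is of relative order
  \<open>1 / 2 ^ N\<close>.\<close>

lemma sum_square_step_block:
  "(\<Sum>i<2 ^ N. (real (j * 2 ^ N + i) + 1)\<^sup>2 - (real (j * 2 ^ N + i))\<^sup>2) = (2 * real j + 1) * 4 ^ N"
proof -
  define F where "F i = (real (j * 2 ^ N + i)) ^ 2" for i
  have "(\<Sum>i<2 ^ N. (real (j * 2 ^ N + i) + 1)\<^sup>2 - (real (j * 2 ^ N + i))\<^sup>2) = (\<Sum>i<2 ^ N. F (Suc i) - F i)"
    by (intro sum.cong refl) (simp add: F_def algebra_simps)
  also have "\<dots> = F (2 ^ N) - F 0" by (rule sum_lessThan_telescope)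
  also have "\<dots> = ((real j + 1) * 2 ^ N) ^ 2 - (real j * 2 ^ N) ^ 2"
    by (simp add: F_def algebra_simps)
  also have "\<dots> = (2 * real j + 1) * (2 ^ N) ^ 2"
    unfolding power_mult_distrib by (simp add: algebra_simps power2_eq_square)
  also have "(2 ^ N :: real) ^ 2 = 4 ^ N"
    by (simp flip: power_mult add: mult.commute[of N]) (simp add: power_mult)
  finally show ?thesis .
qed

text \<open>A cell of level \<open>n + N\<close> lies in the cell whose index is the quotient by
  \<open>2 ^ N\<close>; the remainder \<open>i\<close> numbers the subcells.\<close>

lemma indicator_dyadic_cell_split:
  "(indicator (dyadic_cell n k) x :: ennreal) = (\<Sum>i<2 ^ N. indicator (dyadic_cell (n + N) (k * 2 ^ N + i)) x)"
proof (cases "x \<in> dyadic_cell n k")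
  case True
  define i where "i = dyadic_index (n + N) x mod 2 ^ N"
  have x: "0 \<le> x" "dyadic_index n x = k" using True by (auto simp: mem_dyadic_cell_iff)
  then have "dyadic_index (n + N) x div 2 ^ N = k" using dyadic_index_div[of x n N] by simp
  then have e: "dyadic_index (n + N) x = k * 2 ^ N + i"
    by (metis i_def div_mult_mod_eq)
  have "(\<Sum>i<2 ^ N. indicator (dyadic_cell (n + N) (k * 2 ^ N + i)) x :: ennreal)
      = (\<Sum>i'<2 ^ N. if i' = i then 1 else 0)"
    by (intro sum.cong refl) (auto simp: indicator_def mem_dyadic_cell_iff x e)
  also have "\<dots> = 1" by (simp add: i_def)
  finally show ?thesis using True by simp
next
  case False
  have "x \<notin> dyadic_cell (n + N) (k * 2 ^ N + i)" if "i < 2 ^ N" for i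
  proof
    assume "x \<in> dyadic_cell (n + N) (k * 2 ^ N + i)"
    then have "0 \<le> x" "dyadic_index (n + N) x = k * 2 ^ N + i" by (auto simp: mem_dyadic_cell_iff)
    then have "dyadic_index n x = k" using that dyadic_index_div[of x n N] by simp
    then show False using False \<open>0 \<le> x\<close> by (simp add: mem_dyadic_cell_iff)
  qed
  then show ?thesis using False by simp
qed

lemma nn_integral_cell_ge:
  assumes "\<And>x. x \<in> dyadic_cell n k \<Longrightarrow> ennreal c \<le> f x" "0 \<le> c"
  shows "ennreal (c / 2 ^ n) \<le> (\<integral>\<^sup>+x. f x * indicator (dyadic_cell n k) x \<partial>lborel)"
proof -
  have "ennreal (c / 2 ^ n) = (\<integral>\<^sup>+x. ennreal c * indicator (dyadic_cell n k) x \<partial>lborel)"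
    using assms(2) by (subst nn_integral_cmult_indicator)
      (auto simp: emeasure_dyadic_cell ennreal_mult[symmetric])
  also have "\<dots> \<le> (\<integral>\<^sup>+x. f x * indicator (dyadic_cell n k) x \<partial>lborel)"
    using assms(1) by (intro nn_integral_mono) (auto simp: indicator_def)
  finally show ?thesis .
qed

lemma nn_integral_cell_le:
  assumes "\<And>x. x \<in> dyadic_cell n k \<Longrightarrow> f x \<le> ennreal c" "0 \<le> c"
  shows "(\<integral>\<^sup>+x. f x * indicator (dyadic_cell n k) x \<partial>lborel) \<le> ennreal (c / 2 ^ n)"
proof -
  have "(\<integral>\<^sup>+x. f x * indicator (dyadic_cell n k) x \<partial>lborel)
      \<le> (\<integral>\<^sup>+x. ennreal c * indicator (dyadic_cell n k) x \<partial>lborel)"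
    using assms(1) by (intro nn_integral_mono) (auto simp: indicator_def)
  also have "\<dots> = ennreal (c / 2 ^ n)"
    using assms(2) by (subst nn_integral_cmult_indicator)
      (auto simp: emeasure_dyadic_cell ennreal_mult[symmetric])
  finally show ?thesis .
qed

text \<open>Translation by \<open>y\<close> permutes the cells of every finer level \<open>n + N\<close>, so the integral lies between
  the lower and upper Riemann sums of \<open>x\<^sup>2\<close> on the translated cell, which differ by \<open>O(2 ^ (-N))\<close>. This
  avoids the measure invariance of the dyadic translation.\<close>

lemma nn_integral_dyadic_cell:
  fixes y :: real and n k :: nat
  assumes "0 \<le> y"
  defines "j \<equiv> xor k (dyadic_index n y)"
  shows "(\<integral>\<^sup>+x. ennreal ((dyadic_sum x y)\<^sup>2) * indicator (dyadic_cell n k) x \<partial>lborel)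
    = ennreal (cube_step j / 8 ^ n)" (is "?L = _")
proof -
  define f where "f x = ennreal ((indicator {0..} x * dyadic_sum x y)\<^sup>2)" for x
  have f_meas [measurable]: "f \<in> borel_measurable borel"
    unfolding f_def using dyadic_sum_measurable[OF assms(1)] by measurable
  have f_eq: "ennreal ((dyadic_sum x y)\<^sup>2) * indicator (dyadic_cell n k) x
      = f x * indicator (dyadic_cell n k) x" for x n k
    by (auto simp: f_def indicator_def mem_dyadic_cell_iff)
  have bounds: "ennreal (cube_step j / 8 ^ n - (2 * real j + 1) / 2 ^ N) \<le> ?L \<and>
    ?L \<le> ennreal (cube_step j / 8 ^ n + (2 * real j + 1) / 2 ^ N)" for N
  proof -
    define r where "r = dyadic_index (n + N) y mod 2 ^ N"
    have r: "r < 2 ^ N" by (simp add: r_def)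
    have yr: "dyadic_index (n + N) y = dyadic_index n y * 2 ^ N + r"
      using dyadic_index_div[OF assms(1), of n N] by (simp only: r_def div_mult_mod_eq)
    define m where "m i = xor (k * 2 ^ N + i) (dyadic_index (n + N) y)" for i
    have m: "m i = j * 2 ^ N + xor i r" if "i < 2 ^ N" for i
      using that r by (simp add: m_def yr mult_power_xor j_def)
    \<comment> \<open>As \<open>i\<close> runs below \<open>2 ^ N\<close>, so does
      \<open>xor i r\<close>: translation sends the subcells onto those of cell \<open>j\<close>,
      merely in another order.\<close>
    have reindex: "(\<Sum>i<2 ^ N. g (m i)) = (\<Sum>i<2 ^ N. g (j * 2 ^ N + i))" for g :: "nat \<Rightarrow> real"
      using sum.reindex_bij_betw[OF bij_betw_xor[OF r], of "\<lambda>i. g (j * 2 ^ N + i)"] by (simp add: m)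
    let ?C = "\<lambda>i. \<integral>\<^sup>+x. f x * indicator (dyadic_cell (n + N) (k * 2 ^ N + i)) x \<partial>lborel"
    let ?lo = "\<Sum>i<2 ^ N. (real (m i) / 2 ^ (n + N))\<^sup>2 / 2 ^ (n + N)"
    let ?up = "\<Sum>i<2 ^ N. ((real (m i) + 1) / 2 ^ (n + N))\<^sup>2 / 2 ^ (n + N)"
    have pow: "((2::real) ^ (n + N))\<^sup>2 * 2 ^ (n + N) = 8 ^ n * 8 ^ N"
    proof -
      have "((2::real) ^ (n + N))\<^sup>2 * 2 ^ (n + N) = (2 ^ 3) ^ (n + N)"
        by (simp only: power_mult[symmetric] power_add[symmetric]) (simp add: algebra_simps)
      then show ?thesis by (simp add: power_add)
    qed
    have lo: "?lo = (\<Sum>i<2 ^ N. (real (j * 2 ^ N + i))\<^sup>2) / (8 ^ n * 8 ^ N)"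
      using reindex[of "\<lambda>m. (real m)\<^sup>2"] 
      by (simp only: power_divide divide_divide_eq_left pow sum_divide_distrib[symmetric])
    have up: "?up = (\<Sum>i<2 ^ N. (real (j * 2 ^ N + i) + 1)\<^sup>2) / (8 ^ n * 8 ^ N)"
      using reindex[of "\<lambda>m. (real m + 1)\<^sup>2"] 
      by (simp only: power_divide divide_divide_eq_left pow sum_divide_distrib[symmetric])
    have mid: "cube_step j / 8 ^ n = (\<Sum>i<2 ^ N. cube_step (j * 2 ^ N + i)) / (8 ^ n * 8 ^ N)"
      by (simp add: sum_cube_step_block)
    have "?up - ?lo = (2 * real j + 1) * 4 ^ N / (8 ^ n * 8 ^ N)"
      unfolding lo up diff_divide_distrib[symmetric] sum_subtractf[symmetric] sum_square_step_block ..
    also have "\<dots> = (2 * real j + 1) / (8 ^ n * 2 ^ N)"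
    proof -
      have "(8::real) ^ N = 4 ^ N * 2 ^ N" by (simp flip: power_mult_distrib)
      then show ?thesis by simp
    qed
    also have "\<dots> \<le> (2 * real j + 1) / 2 ^ N"
    proof (rule divide_left_mono)
      have "(1::real) * 2 ^ N \<le> 8 ^ n * 2 ^ N" by (intro mult_right_mono) auto
      then show "(2::real) ^ N \<le> 8 ^ n * 2 ^ N" by simp
    qed auto
    finally have diff: "?up - ?lo \<le> (2 * real j + 1) / 2 ^ N" .
    have lo_le: "?lo \<le> cube_step j / 8 ^ n"
      unfolding lo mid by (intro divide_right_mono sum_mono cube_step_ge) auto
    have le_up: "cube_step j / 8 ^ n \<le> ?up"
      unfolding up mid by (intro divide_right_mono sum_mono cube_step_le) auto
    have L: "?L = (\<Sum>i<2 ^ N. ?C i)"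
      unfolding f_eq indicator_dyadic_cell_split[of n k _ N] sum_distrib_left
      by (intro nn_integral_sum) measurable
    have "ennreal (cube_step j / 8 ^ n - (2 * real j + 1) / 2 ^ N) \<le> ennreal ?lo"
      using le_up diff by (intro ennreal_leI) linarith
    also have "ennreal ?lo \<le> (\<Sum>i<2 ^ N. ?C i)"
    proof -
      have "ennreal ((real (m i) / 2 ^ (n + N))\<^sup>2 / 2 ^ (n + N)) \<le> ?C i" for i
        by (rule nn_integral_cell_ge)
           (auto simp: f_def m_def mem_dyadic_cell_iff assms(1) intro!: ennreal_leI power_mono,
            metis assms(1) dyadic_sum_bounds(1))
      then have "(\<Sum>i<2 ^ N. ennreal ((real (m i) / 2 ^ (n + N))\<^sup>2 / 2 ^ (n + N))) \<le> (\<Sum>i<2 ^ N. ?C i)"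
        by (intro sum_mono)
      then show ?thesis by (subst (asm) sum_ennreal) simp_all
    qed
    finally have 1: "ennreal (cube_step j / 8 ^ n - (2 * real j + 1) / 2 ^ N) \<le> ?L"
      unfolding L .
    have "(\<Sum>i<2 ^ N. ?C i) \<le> ennreal ?up"
    proof -
      have "?C i \<le> ennreal (((real (m i) + 1) / 2 ^ (n + N))\<^sup>2 / 2 ^ (n + N))" for i
        by (rule nn_integral_cell_le)
           (auto simp: f_def m_def mem_dyadic_cell_iff assms(1) dyadic_sum_nonneg intro!: ennreal_leI power_mono,
            metis assms(1) dyadic_sum_bounds(2))
      then have "(\<Sum>i<2 ^ N. ?C i) \<le> (\<Sum>i<2 ^ N. ennreal (((real (m i) + 1) / 2 ^ (n + N))\<^sup>2 / 2 ^ (n + N)))"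
        by (intro sum_mono)
      then show ?thesis by (subst (asm) sum_ennreal) simp_all
    qed
    also have "\<dots> \<le> ennreal (cube_step j / 8 ^ n + (2 * real j + 1) / 2 ^ N)"
      using lo_le diff by (intro ennreal_leI) linarith
    finally show ?thesis using 1 unfolding L by blast
  qed
  have "?L \<noteq> top" using bounds[of 0] by (auto simp: top_unique)
  then obtain l where l: "?L = ennreal l" "0 \<le> l" by (cases ?L) auto
  have lim: "(\<lambda>N. (2 * real j + 1) / 2 ^ N) \<longlonglongrightarrow> 0"
  proof -
    have "(\<lambda>N. (2 * real j + 1) * (1 / 2) ^ N) \<longlonglongrightarrow> (2 * real j + 1) * 0"
      by (intro tendsto_mult tendsto_const LIMSEQ_power_zero) simp
    then show ?thesis by (simp add: power_divide)
  qed
  have b: "cube_step j / 8 ^ n - (2 * real j + 1) / 2 ^ N \<le> l" "l \<le> cube_step j / 8 ^ n + (2 * real j + 1) / 2 ^ N" for N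
  proof -
    have nn: "0 \<le> cube_step j / 8 ^ n + (2 * real j + 1) / 2 ^ N"
      by (intro add_nonneg_nonneg divide_nonneg_nonneg) (simp_all add: cube_step_nonneg)
    show "cube_step j / 8 ^ n - (2 * real j + 1) / 2 ^ N \<le> l"
      using bounds[of N] l(2) unfolding l(1) by (simp only: ennreal_le_iff)
    show "l \<le> cube_step j / 8 ^ n + (2 * real j + 1) / 2 ^ N"
      using bounds[of N] nn unfolding l(1) by (simp only: ennreal_le_iff)
  qed
  have "cube_step j / 8 ^ n \<le> l"
    by (rule LIMSEQ_le_const2[of "\<lambda>N. cube_step j / 8 ^ n - (2 * real j + 1) / 2 ^ N"])
       (use tendsto_diff[OF tendsto_const lim] b in auto)
  moreover have "l \<le> cube_step j / 8 ^ n"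
    by (rule LIMSEQ_le_const[of "\<lambda>N. cube_step j / 8 ^ n + (2 * real j + 1) / 2 ^ N"])
       (use tendsto_add[OF tendsto_const lim] b in auto)
  ultimately show ?thesis using l by simp
qed

section \<open>Norms, moments and the uncertainty functional of step functions on the
  half-line\<close>

lemma nn_integral_Rplus: "(\<integral>\<^sup>+x. f x \<partial>Rplus) = (\<integral>\<^sup>+x. f x * indicator {0..} x \<partial>lborel)"
  by (simp add: nn_integral_restrict_space nn_integral_completion)

lemma dyadic_step_expand:
  assumes "\<And>x. 0 \<le> x \<Longrightarrow> g x = (if dyadic_index n x < M then v (dyadic_index n x) else 0)"
  shows "ennreal ((cmod (g x))\<^sup>2) * indicator {0..} x
    = (\<Sum>k<M. ennreal ((cmod (v k))\<^sup>2) * indicator (dyadic_cell n k) x)"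
proof (cases "0 \<le> x")
  case True
  have "(\<Sum>k<M. ennreal ((cmod (v k))\<^sup>2) * indicator (dyadic_cell n k) x)
      = (\<Sum>k<M. if k = dyadic_index n x then ennreal ((cmod (v (dyadic_index n x)))\<^sup>2) else 0)"
    using True by (intro sum.cong) (auto simp: mem_dyadic_cell_iff indicator_def)
  also have "\<dots> = ennreal ((cmod (g x))\<^sup>2) * indicator {0..} x"
    using True assms by (auto simp: sum.delta')
  finally show ?thesis ..
qed (auto simp: mem_dyadic_cell_iff)

lemma dyadic_step_moment:
  assumes "\<And>x. 0 \<le> x \<Longrightarrow> g x = (if dyadic_index n x < M then v (dyadic_index n x) else 0)" "0 \<le> y"
  shows "(\<integral>\<^sup>+ x. ennreal ((dyadic_sum x y)\<^sup>2 * (cmod (g x))\<^sup>2) \<partial>Rplus)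
    = ennreal (\<Sum>k<M. (cmod (v k))\<^sup>2 * (cube_step (xor k (dyadic_index n y)) / 8 ^ n))"
proof -
  define w where "w x = ennreal ((indicator {0..} x * dyadic_sum x y)\<^sup>2)" for x
  have w_meas [measurable]: "w \<in> borel_measurable borel"
    unfolding w_def using dyadic_sum_measurable[OF assms(2)] by measurable
  have e: "ennreal ((dyadic_sum x y)\<^sup>2 * (cmod (g x))\<^sup>2) * indicator {0..} x
      = (\<Sum>k<M. ennreal ((cmod (v k))\<^sup>2) * (w x * indicator (dyadic_cell n k) x))" for x
  proof -
    have "ennreal ((dyadic_sum x y)\<^sup>2 * (cmod (g x))\<^sup>2) * indicator {0..} x
        = w x * (ennreal ((cmod (g x))\<^sup>2) * indicator {0..} x)"
      by (auto simp: w_def indicator_def ennreal_mult)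
    then show ?thesis
      using dyadic_step_expand[where g = g and v = v and n = n and M = M and x = x, OF assms(1)]
      by (simp only: sum_distrib_left mult.left_commute)
  qed
  have c: "(\<integral>\<^sup>+x. w x * indicator (dyadic_cell n k) x \<partial>lborel)
      = ennreal (cube_step (xor k (dyadic_index n y)) / 8 ^ n)" for k
    unfolding nn_integral_dyadic_cell[OF assms(2), symmetric]
    by (intro nn_integral_cong) (auto simp: w_def indicator_def mem_dyadic_cell_iff)
  have "(\<integral>\<^sup>+ x. ennreal ((dyadic_sum x y)\<^sup>2 * (cmod (g x))\<^sup>2) \<partial>Rplus)
      = (\<Sum>k<M. \<integral>\<^sup>+x. ennreal ((cmod (v k))\<^sup>2) * (w x * indicator (dyadic_cell n k) x) \<partial>lborel)"
    unfolding nn_integral_Rplus e by (intro nn_integral_sum) measurable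
  also have "\<dots> = (\<Sum>k<M. ennreal ((cmod (v k))\<^sup>2 * (cube_step (xor k (dyadic_index n y)) / 8 ^ n)))"
    by (intro sum.cong refl, subst nn_integral_cmult)
       (simp_all add: c ennreal_mult cube_step_nonneg del: times_divide_eq_right)
  finally show ?thesis by (simp add: sum_nonneg cube_step_nonneg)
qed

lemma dyadic_step_sq_norm:
  assumes "\<And>x. 0 \<le> x \<Longrightarrow> g x = (if dyadic_index n x < M then v (dyadic_index n x) else 0)"
  shows "sq_norm g = ennreal (\<Sum>k<M. (cmod (v k))\<^sup>2 * (1 / 2 ^ n))"
proof -
  have "sq_norm g = (\<integral>\<^sup>+x. (\<Sum>k<M. ennreal ((cmod (v k))\<^sup>2) * indicator (dyadic_cell n k) x) \<partial>lborel)"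
    unfolding sq_norm_def nn_integral_Rplus by (intro nn_integral_cong dyadic_step_expand assms)
  also have "\<dots> = (\<Sum>k<M. \<integral>\<^sup>+x. ennreal ((cmod (v k))\<^sup>2) * indicator (dyadic_cell n k) x \<partial>lborel)"
    by (intro nn_integral_sum) measurable
  also have "\<dots> = (\<Sum>k<M. ennreal ((cmod (v k))\<^sup>2 * (1 / 2 ^ n)))"
    by (intro sum.cong refl, subst nn_integral_cmult_indicator)
       (simp_all only: emeasure_dyadic_cell ennreal_mult' zero_le_power2 zero_le_divide_1_iff,
        simp_all)
  finally show ?thesis by (simp add: sum_nonneg)
qed

text \<open>Every index \<open>q\<close> is attained, at the point \<open>q / 2 ^ n\<close>, and
  those from \<open>2 ^ m\<close> on do not beat their remainders. So the infimum over the half-line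
  is a minimum over a finite set.\<close>

lemma INF_dyadic_index_mod:
  fixes G :: "nat \<Rightarrow> real"
  assumes "\<And>q. G (q mod 2 ^ m) \<le> G q" 
  shows "(INF y\<in>{0..}. ennreal (G (dyadic_index n y))) = ennreal (Min (G ` {..<2 ^ m}))"
proof (rule antisym)
  have "Min (G ` {..<2 ^ m}) \<in> G ` {..<2 ^ m}"
    by (rule Min_in) (auto simp: lessThan_empty_iff)
  then obtain q where q: "q < 2 ^ m" "Min (G ` {..<2 ^ m}) = G q" by auto
  have "(INF y\<in>{0..}. ennreal (G (dyadic_index n y))) \<le> ennreal (G (dyadic_index n (real q / 2 ^ n)))"
    by (rule INF_lower) simp
  then show "(INF y\<in>{0..}. ennreal (G (dyadic_index n y))) \<le> ennreal (Min (G ` {..<2 ^ m}))"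
    by (simp add: q)
  show "ennreal (Min (G ` {..<2 ^ m})) \<le> (INF y\<in>{0..}. ennreal (G (dyadic_index n y)))"
  proof (rule INF_greatest, rule ennreal_leI)
    fix y
    have "Min (G ` {..<2 ^ m}) \<le> G (dyadic_index n y mod 2 ^ m)"
      by (rule Min_le) auto
    then show "Min (G ` {..<2 ^ m}) \<le> G (dyadic_index n y)"
      using assms[of "dyadic_index n y"] by linarith
  qed
qed

text \<open>Here \<open>n\<close> is the level and \<open>2 ^ m\<close> the number of cells: the
  partial sums use \<open>m = n\<close>, their transforms use level \<open>0\<close>. Substituting
  \<open>xor k q\<close> for \<open>k\<close> moves the translation from the weight to the
  values.\<close>

lemma V_dyadic_step:
  assumes g: "\<And>x. 0 \<le> x \<Longrightarrow> g x = (if dyadic_index n x < 2 ^ m then v (dyadic_index n x) else 0)" 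
    and pos: "0 < (\<Sum>k<2 ^ m. (cmod (v k))\<^sup>2)"
  shows "V g = ennreal (Min ((\<lambda>q. \<Sum>k<2 ^ m. (cmod (v (xor k q)))\<^sup>2 * (cube_step k / 8 ^ n)) ` {..<2 ^ m})
       / (\<Sum>k<2 ^ m. (cmod (v k))\<^sup>2 * (1 / 2 ^ n)))"
proof -
  define G where "G q = (\<Sum>k<2 ^ m. (cmod (v k))\<^sup>2 * (cube_step (xor k q) / 8 ^ n))" for q
  have "G (q mod 2 ^ m) \<le> G q" for q
    unfolding G_def
    by (intro sum_mono mult_left_mono divide_right_mono cube_step_mono xor_mod_power_le) auto
  then have "(INF y\<in>{0..}. ennreal (G (dyadic_index n y))) = ennreal (Min (G ` {..<2 ^ m}))"
    by (rule INF_dyadic_index_mod)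
  moreover have "G q = (\<Sum>k<2 ^ m. (cmod (v (xor k q)))\<^sup>2 * (cube_step k / 8 ^ n))" if "q < 2 ^ m" for q
    using sum.reindex_bij_betw[OF bij_betw_xor[OF that], of "\<lambda>k. (cmod (v k))\<^sup>2 * (cube_step (xor k q) / 8 ^ n)"]
    by (simp add: G_def xor.assoc)
  then have "G ` {..<2 ^ m} = (\<lambda>q. \<Sum>k<2 ^ m. (cmod (v (xor k q)))\<^sup>2 * (cube_step k / 8 ^ n)) ` {..<2 ^ m}"
    by (intro image_cong) auto
  moreover have "0 \<le> Min (G ` {..<2 ^ m})"
    by (subst Min_ge_iff) (auto simp: G_def lessThan_empty_iff cube_step_nonneg intro!: sum_nonneg)
  moreover have "0 < (\<Sum>k<2 ^ m. (cmod (v k))\<^sup>2 * (1 / 2 ^ n))"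
    using pos by (simp only: sum_distrib_right[symmetric]) simp
  moreover have "(INF y\<in>{0..}. \<integral>\<^sup>+ x. ennreal ((dyadic_sum x y)\<^sup>2 * (cmod (g x))\<^sup>2) \<partial>Rplus)
      = (INF y\<in>{0..}. ennreal (G (dyadic_index n y)))"
    by (intro INF_cong refl) (simp only: dyadic_step_moment[where g = g and v = v, OF g] atLeast_iff G_def)
  ultimately show ?thesis
    using dyadic_step_sq_norm[where g = g and v = v, OF g] by (simp only: V_def divide_ennreal)
qed

subsection \<open>Walsh polynomials\<close>

text \<open>The value of \<open>w(k,\<cdot>)\<close> on the \<open>m\<close>-th dyadic cell of level \<open>n\<close>, for \<open>k, m < 2 ^ n\<close>.\<close>

definition walsh_bits :: "nat \<Rightarrow> nat \<Rightarrow> nat \<Rightarrow> real" where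
  "walsh_bits n k m = (\<Prod>i<n. if bit k i \<and> bit m (n - 1 - i) then - 1 else 1)"

lemma dyadic_index_less_iff: "0 \<le> x \<Longrightarrow> dyadic_index n x < 2 ^ n \<longleftrightarrow> x < 1"
proof
  assume x: "0 \<le> x" and "dyadic_index n x < 2 ^ n"
  then have "\<lfloor>x * 2 ^ n\<rfloor> < 2 ^ n" by (simp add: dyadic_index_def nat_less_iff)
  then have "x * 2 ^ n < 2 ^ n" by (simp add: floor_less_iff)
  then show "x < 1" by simp
qed (rule dyadic_index_less)

text \<open>A digit of \<open>x\<close> at a negative position vanishes since \<open>x < 1\<close>,
  which leaves the digits of \<open>t\<close> at negative positions; those below \<open>-n\<close>
  vanish by the bound on the index. Hence the fractional part of \<open>t\<close> has no influence,
  and the transform of a function living on \<open>[0,1)\<close> is constant on unit cells.\<close>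

lemma walsh_eq_walsh_bits:
  assumes "0 \<le> t" "0 \<le> x" "x < 1" "dyadic_index 0 t < 2 ^ n"
  shows "walsh t x = walsh_bits n (dyadic_index 0 t) (dyadic_index n x)"
proof -
  let ?e = "\<lambda>j. dyadic_digit t j * dyadic_digit x (- j - 1)"
  let ?A = "(\<lambda>i. - int i - 1) ` {..<n}"
  have x0: "dyadic_index 0 x = 0" using dyadic_index_less[OF assms(3), of 0] by simp
  have outside: "?e j = 0" if "j \<notin> ?A" for j
  proof (cases "j < 0")
    case True
    then have "j = - int (nat (- 1 - j)) - 1" by simp
    then have "\<not> nat (- 1 - j) < n" using that by blast
    then have "\<not> bit (dyadic_index 0 t) (nat (- 1 - j))"
      using assms(4) by (metis bit_take_bit_iff take_bit_nat_eq_self)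
    then show ?thesis using True assms(1) by (simp add: dyadic_digit_eq_bit[where n = 0])
  next
    case False
    then show ?thesis using assms(2) x0 by (simp add: dyadic_digit_eq_bit[where n = 0])
  qed
  have "(\<Sum>j | ?e j \<noteq> 0. ?e j) = (\<Sum>j\<in>?A. ?e j)"
  proof (rule sum.mono_neutral_left)
    show "{j. ?e j \<noteq> 0} \<subseteq> ?A"
      by (rule subsetI, rule ccontr) (drule outside, simp)
  qed simp_all
  also have "\<dots> = (\<Sum>i<n. ?e (- int i - 1))"
    by (subst sum.reindex) (auto simp: inj_on_def)
  also have "\<dots> = (\<Sum>i<n. of_bool (bit (dyadic_index 0 t) i \<and> bit (dyadic_index n x) (n - 1 - i)))"
  proof (rule sum.cong[OF refl])
    fix i assume "i \<in> {..<n}"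
    then have "dyadic_digit x (int i) = of_bool (bit (dyadic_index n x) (nat (int n - 1 - int i)))"
      using assms(2) by (intro dyadic_digit_eq_bit) auto
    moreover have "nat (int n - 1 - int i) = n - 1 - i" using \<open>i \<in> {..<n}\<close> by auto
    moreover have "dyadic_digit t (- int i - 1) = of_bool (bit (dyadic_index 0 t) i)"
      using assms(1) by (subst dyadic_digit_eq_bit[where n = 0]) auto
    ultimately show "?e (- int i - 1) = of_bool (bit (dyadic_index 0 t) i \<and> bit (dyadic_index n x) (n - 1 - i))"
      by simp
  qed
  finally have "walsh t x
      = (\<Prod>i<n. (- 1) ^ of_bool (bit (dyadic_index 0 t) i \<and> bit (dyadic_index n x) (n - 1 - i)))"
    unfolding walsh_def by (simp only: power_sum)
  also have "\<dots> = walsh_bits n (dyadic_index 0 t) (dyadic_index n x)"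
    unfolding walsh_bits_def by (intro prod.cong refl) simp
  finally show ?thesis .
qed

text \<open>The reversal \<open>n - 1 - i\<close> of the bit positions exchanges the two
  arguments.\<close>

lemma walsh_bits_commute: "walsh_bits n k m = walsh_bits n m k"
proof -
  have "(\<Prod>i<n. if bit k i \<and> bit m (n - 1 - i) then - 1 else 1::real)
      = (\<Prod>i<n. if bit m i \<and> bit k (n - 1 - i) then - 1 else 1)"
  proof (rule prod.reindex_bij_witness[where i = "\<lambda>i. n - 1 - i" and j = "\<lambda>i. n - 1 - i"])
    fix i assume "i \<in> {..<n}"
    then have "n - 1 - (n - 1 - i) = i" by auto
    then show "(if bit m (n - 1 - i) \<and> bit k (n - 1 - (n - 1 - i)) then - 1 else 1)
        = (if bit k i \<and> bit m (n - 1 - i) then - 1 else (1::real))"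
      by (simp only: conj_commute)
  qed auto
  then show ?thesis by (simp only: walsh_bits_def)
qed

text \<open>Walsh functions are characters for exclusive or; with \<open>sum_walsh_bits\<close> this
  gives their orthogonality.\<close>

lemma walsh_bits_xor: "walsh_bits n (xor k l) m = walsh_bits n k m * walsh_bits n l m"
  unfolding walsh_bits_def prod.distrib[symmetric]
proof (intro prod.cong refl)
  fix i
  show "(if bit (xor k l) i \<and> bit m (n - 1 - i) then - 1 else 1) =
    (if bit k i \<and> bit m (n - 1 - i) then - 1 else 1) *
      (if bit l i \<and> bit m (n - 1 - i) then - 1 else (1::real))"
    by (cases "bit k i"; cases "bit l i") (simp_all add: bit_xor_iff)
qed

text \<open>Flipping the bit of \<open>m\<close> that pairs with a set bit of \<open>k\<close> changes the sign of each term.\<close>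

lemma sum_walsh_bits:
  assumes "k < 2 ^ n"
  shows "(\<Sum>m<2 ^ n. walsh_bits n k m) = (if k = 0 then 2 ^ n else 0)"
proof (cases "k = 0")
  case True
  then show ?thesis by (simp add: walsh_bits_def)
next
  case False
  then obtain i where i: "bit k i" by (auto simp: bit_eq_iff)
  then have "i < n" using assms by (metis bit_take_bit_iff take_bit_nat_eq_self)
  define q :: nat where "q = 2 ^ (n - 1 - i)"
  have "walsh_bits n k q = (\<Prod>i'<n. if i' = i then - 1 else 1)"
    unfolding walsh_bits_def 
  proof (intro prod.cong refl)
    fix i' assume "i' \<in> {..<n}"
    then have "bit q (n - 1 - i') \<longleftrightarrow> i' = i"
      using \<open>i < n\<close> by (auto simp: q_def bit_exp_iff)
    then show "(if bit k i' \<and> bit q (n - 1 - i') then - 1 else 1) = (if i' = i then - 1 else (1::real))"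
      using i by auto
  qed
  then have q1: "walsh_bits n k q = - 1" using \<open>i < n\<close> by simp
  have q: "q < 2 ^ n" using \<open>i < n\<close> by (simp add: q_def)
  have "(\<Sum>m<2 ^ n. walsh_bits n k m) = (\<Sum>m<2 ^ n. walsh_bits n k (xor m q))"
    using sum.reindex_bij_betw[OF bij_betw_xor[OF q], of "walsh_bits n k"] by simp
  also have "\<dots> = - (\<Sum>m<2 ^ n. walsh_bits n k m)"
    by (simp add: walsh_bits_commute[of n k] walsh_bits_xor q1[unfolded walsh_bits_commute[of n k q]] sum_negf)
  finally show ?thesis using False by simp
qed

lemma walsh_bits_orthogonal:
  assumes "k < 2 ^ n" "l < 2 ^ n"
  shows "(\<Sum>m<2 ^ n. walsh_bits n k m * walsh_bits n l m) = (if k = l then 2 ^ n else 0)"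
proof -
  have "xor k l = 0 \<longleftrightarrow> k = l"
    by (metis xor.assoc xor.left_neutral xor.right_neutral xor_self_eq)
  then show ?thesis
    using sum_walsh_bits[OF xor_less_power[OF assms]] by (simp add: walsh_bits_xor)
qed

text \<open>The fast Walsh transform without its normalization: the value of the Walsh polynomial on
  the \<open>m\<close>-th cell of level \<open>n\<close>.\<close>

definition walsh_value :: "nat \<Rightarrow> (nat \<Rightarrow> complex) \<Rightarrow> nat \<Rightarrow> complex" where
  "walsh_value n a m = (\<Sum>k<2 ^ n. a k * complex_of_real (walsh_bits n k m))"

lemma walsh_value_parseval:
  "(\<Sum>m<2 ^ n. (cmod (walsh_value n a m))\<^sup>2) = 2 ^ n * (\<Sum>k<2 ^ n. (cmod (a k))\<^sup>2)"
proof -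
  have "complex_of_real (\<Sum>m<2 ^ n. (cmod (walsh_value n a m))\<^sup>2)
      = (\<Sum>m<2 ^ n. \<Sum>k<2 ^ n. \<Sum>l<2 ^ n. a k * cnj (a l) *
           complex_of_real (walsh_bits n k m * walsh_bits n l m))"
    unfolding of_real_sum complex_norm_square walsh_value_def cnj_sum sum_product
    by (intro sum.cong refl) simp
  also have "\<dots> = (\<Sum>k<2 ^ n. \<Sum>l<2 ^ n. \<Sum>m<2 ^ n. a k * cnj (a l) *
           complex_of_real (walsh_bits n k m * walsh_bits n l m))"
    by (subst sum.swap) (intro sum.cong refl sum.swap)
  also have "\<dots> = (\<Sum>k<2 ^ n. \<Sum>l<2 ^ n. if k = l then a k * cnj (a k) * 2 ^ n else 0)"
  proof (intro sum.cong refl)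
    fix k l :: nat assume "k \<in> {..<2 ^ n}" "l \<in> {..<2 ^ n}"
    then have "complex_of_real (\<Sum>m<2 ^ n. walsh_bits n k m * walsh_bits n l m)
        = (if k = l then 2 ^ n else 0)"
      by (simp add: walsh_bits_orthogonal)
    then show "(\<Sum>m<2 ^ n. a k * cnj (a l) * complex_of_real (walsh_bits n k m * walsh_bits n l m))
        = (if k = l then a k * cnj (a k) * 2 ^ n else 0)"
      unfolding sum_distrib_left[symmetric] of_real_sum[symmetric] by simp
  qed
  also have "\<dots> = complex_of_real (2 ^ n * (\<Sum>k<2 ^ n. (cmod (a k))\<^sup>2))"
    by (simp add: complex_norm_square[symmetric] sum_distrib_left mult.commute)
  finally show ?thesis by (simp only: of_real_eq_iff)
qed

lemma fast_walsh_transform_eq: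
  assumes "m < 2 ^ n"
  shows "fast_walsh_transform n a m = complex_of_real (2 powr (- real n / 2)) * walsh_value n a m"
proof -
  have "walsh (real m) (real k / 2 ^ n) = walsh_bits n k m" if "k < 2 ^ n" for k
  proof -
    have "real k < 2 ^ n" using that by (metis of_nat_less_iff of_nat_numeral of_nat_power)
    then show ?thesis
      using assms walsh_eq_walsh_bits[of "real m" "real k / 2 ^ n" n] by (simp add: walsh_bits_commute)
  qed
  then show ?thesis
    by (simp add: fast_walsh_transform_def walsh_matrix_def walsh_value_def sum_distrib_left mult.left_commute)
qed

lemma norm_fast_walsh_transform:
  assumes "m < 2 ^ n"
  shows "(cmod (fast_walsh_transform n a m))\<^sup>2 = (cmod (walsh_value n a m))\<^sup>2 / 2 ^ n"
proof -
  have "(2 powr (- real n / 2))\<^sup>2 = 2 powr (- real n)"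
    by (simp add: powr_power)
  also have "\<dots> = 1 / 2 ^ n" by (simp add: powr_minus powr_realpow field_simps)
  finally show ?thesis
    by (simp add: fast_walsh_transform_eq[OF assms] norm_mult power_mult_distrib)
qed

section \<open>Partial sums of a Walsh series and their transforms\<close>

definition walsh_partial :: "nat \<Rightarrow> (nat \<Rightarrow> complex) \<Rightarrow> real \<Rightarrow> complex" where
  "walsh_partial n a x = indicator {0..<1} x * (\<Sum>k<2 ^ n. a k * complex_of_real (walsh (real k) x))"

lemma walsh_partial_step:
  assumes "0 \<le> x"
  shows "walsh_partial n a x
    = (if dyadic_index n x < 2 ^ n then walsh_value n a (dyadic_index n x) else 0)"
proof (cases "x < 1")
  case True
  then have "walsh (real k) x = walsh_bits n k (dyadic_index n x)" if "k < 2 ^ n" for k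
    using assms that walsh_eq_walsh_bits[of "real k" x n] by simp
  then show ?thesis
    using True assms by (simp add: walsh_partial_def walsh_value_def dyadic_index_less)
qed (use dyadic_index_less_iff[OF assms] in \<open>simp add: walsh_partial_def\<close>)

lemma has_bochner_integral_dyadic_step:
  fixes h :: "real \<Rightarrow> complex"
  assumes "\<And>x. 0 \<le> x \<Longrightarrow> h x = (if dyadic_index n x < M then v (dyadic_index n x) else 0)"
  shows "has_bochner_integral Rplus h (\<Sum>m<M. v m / 2 ^ n)"
proof -
  have sub: "dyadic_cell n m \<subseteq> {0..}" for m by (auto simp: mem_dyadic_cell_iff)
  have sets: "dyadic_cell n m \<in> sets Rplus" for m
    using sub by (simp add: sets_restrict_space_iff)
  have em: "emeasure Rplus (dyadic_cell n m) = ennreal (1 / 2 ^ n)" for m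
    using sub by (subst emeasure_restrict_space) (auto simp: emeasure_dyadic_cell)
  have "has_bochner_integral Rplus (\<lambda>x. indicator (dyadic_cell n m) x *\<^sub>R v m) (v m / 2 ^ n)" for m
  proof -
    have "has_bochner_integral Rplus (\<lambda>x. indicator (dyadic_cell n m) x *\<^sub>R v m)
       (measure Rplus (dyadic_cell n m) *\<^sub>R v m)"
      by (intro has_bochner_integral_scaleR_left has_bochner_integral_real_indicator sets)
         (simp add: em)
    moreover have "measure Rplus (dyadic_cell n m) = 1 / 2 ^ n"
      by (simp add: measure_def em)
    ultimately show ?thesis by (simp add: scaleR_conv_of_real)
  qed
  then have "has_bochner_integral Rplus (\<lambda>x. \<Sum>m<M. indicator (dyadic_cell n m) x *\<^sub>R v m)
      (\<Sum>m<M. v m / 2 ^ n)"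
    by (rule has_bochner_integral_sum)
  moreover have eq: "h x = (\<Sum>m<M. indicator (dyadic_cell n m) x *\<^sub>R v m)" if "x \<in> space Rplus" for x
  proof -
    have "(\<Sum>m<M. indicator (dyadic_cell n m) x *\<^sub>R v m)
        = (\<Sum>m<M. if m = dyadic_index n x then v m else 0)"
      using that by (intro sum.cong) (auto simp: mem_dyadic_cell_iff indicator_def)
    then show ?thesis using that assms[of x] by auto
  qed
  ultimately show ?thesis by (subst has_bochner_integral_cong[OF refl eq refl])
qed

text \<open>At a level \<open>N\<close> with \<open>n \<le> N\<close> that also accommodates the
  index of \<open>t\<close>, both factors are step functions given by \<open>walsh_bits N\<close>.
  The integral is then a finite sum, and orthogonality picks out the coefficient whose index is that
  of \<open>t\<close>.\<close>

lemma has_bochner_integral_walsh_partial: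
  assumes "0 \<le> t"
  shows "has_bochner_integral Rplus (\<lambda>x. walsh_partial n a x * complex_of_real (walsh t x))
    (if dyadic_index 0 t < 2 ^ n then a (dyadic_index 0 t) else 0)"
proof -
  define l where "l = dyadic_index 0 t"
  obtain N' where "l < 2 ^ N'" using less_exp by blast
  define N where "N = max n N'"
  have N: "n \<le> N" "l < 2 ^ N"
    using \<open>l < 2 ^ N'\<close> by (auto simp: N_def intro: less_le_trans power_increasing)
  have less: "k < 2 ^ N" if "k < 2 ^ n" for k :: nat
    using that power_increasing[OF N(1), of "2::nat"] by linarith
  let ?v = "\<lambda>m. \<Sum>k<2 ^ n. a k * complex_of_real (walsh_bits N k m * walsh_bits N l m)"
  have "has_bochner_integral Rplus (\<lambda>x. walsh_partial n a x * complex_of_real (walsh t x))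
    (\<Sum>m<2 ^ N. ?v m / 2 ^ N)"
  proof (rule has_bochner_integral_dyadic_step)
    fix x :: real assume x: "0 \<le> x"
    show "walsh_partial n a x * complex_of_real (walsh t x)
        = (if dyadic_index N x < 2 ^ N then ?v (dyadic_index N x) else 0)"
    proof (cases "x < 1")
      case True
      have "walsh (real k) x = walsh_bits N k (dyadic_index N x)" if "k < 2 ^ n" for k
        using x True less[OF that] walsh_eq_walsh_bits[of "real k" x N] by simp
      moreover have "walsh t x = walsh_bits N l (dyadic_index N x)"
        using x True N walsh_eq_walsh_bits[of t x N] assms by (simp add: l_def)
      ultimately show ?thesis
        using x True by (simp add: walsh_partial_def dyadic_index_less sum_distrib_right mult.assoc)
    qed (use dyadic_index_less_iff[OF x] in \<open>simp add: walsh_partial_def\<close>)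
  qed
  moreover have "(\<Sum>m<2 ^ N. ?v m / 2 ^ N) = (if l < 2 ^ n then a l else 0)"
  proof -
    have "(\<Sum>m<2 ^ N. ?v m / 2 ^ N) = (\<Sum>m<2 ^ N. \<Sum>k<2 ^ n. a k * complex_of_real (walsh_bits N k m * walsh_bits N l m) / 2 ^ N)"
      by (simp only: sum_divide_distrib)
    also have "\<dots> = (\<Sum>k<2 ^ n. \<Sum>m<2 ^ N. a k * complex_of_real (walsh_bits N k m * walsh_bits N l m) / 2 ^ N)"
      by (rule sum.swap)
    also have "\<dots> = (\<Sum>k<2 ^ n. if k = l then a k else 0)"
    proof (intro sum.cong refl)
      fix k assume "k \<in> {..<(2::nat) ^ n}"
      then have "complex_of_real (\<Sum>m<2 ^ N. walsh_bits N k m * walsh_bits N l m) = (if k = l then 2 ^ N else 0)"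
        using less N by (simp add: walsh_bits_orthogonal)
      then show "(\<Sum>m<2 ^ N. a k * complex_of_real (walsh_bits N k m * walsh_bits N l m) / 2 ^ N)
          = (if k = l then a k else 0)"
        unfolding sum_distrib_left[symmetric] of_real_sum[symmetric] sum_divide_distrib[symmetric] by simp
    qed
    finally show ?thesis by simp
  qed
  ultimately have "has_bochner_integral Rplus (\<lambda>x. walsh_partial n a x * complex_of_real (walsh t x))
    (if l < 2 ^ n then a l else 0)" by (simp only:)
  then show ?thesis unfolding l_def .
qed

lemma walsh_0 [simp]: "walsh 0 x = 1"
  by (simp add: walsh_def dyadic_digit_def)

lemma integrable_walsh_partial: "integrable Rplus (walsh_partial n a)"
  using has_bochner_integral_walsh_partial[of 0 n a] 
  by (auto simp: has_bochner_integral_iff)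

lemma walsh_transform_walsh_partial:
  assumes "0 \<le> t"
  shows "walsh_transform (walsh_partial n a) t
    = (if dyadic_index 0 t < 2 ^ n then a (dyadic_index 0 t) else 0)"
  using has_bochner_integral_walsh_partial[OF assms, of n a]
  by (simp add: walsh_transform_def integrable_walsh_partial walsh_integral_def
      has_bochner_integral_integral_eq)

lemma V_walsh_partial:
  assumes "0 < (\<Sum>k<2 ^ n. (cmod (a k))\<^sup>2)"
  shows "V (walsh_partial n a) = ennreal
      (Min ((\<lambda>k0. \<Sum>k<2 ^ n. (cmod (fast_walsh_transform n a (xor k k0)))\<^sup>2
                     * ((real k + 1) ^ 3 - real k ^ 3) / 2 ^ (2 * n) / 3) ` {..<2 ^ n})
       / (\<Sum>k<2 ^ n. (cmod (a k))\<^sup>2))"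
proof -
  let ?v = "walsh_value n a"
  have "0 < (\<Sum>k<2 ^ n. (cmod (?v k))\<^sup>2)"
    unfolding walsh_value_parseval by (intro mult_pos_pos assms) simp
  then have "V (walsh_partial n a) = ennreal
     (Min ((\<lambda>q. \<Sum>k<2 ^ n. (cmod (?v (xor k q)))\<^sup>2 * (cube_step k / 8 ^ n)) ` {..<2 ^ n})
       / (\<Sum>k<2 ^ n. (cmod (?v k))\<^sup>2 * (1 / 2 ^ n)))"
    by (intro V_dyadic_step walsh_partial_step)
  also have "(\<Sum>k<2 ^ n. (cmod (?v k))\<^sup>2 * (1 / 2 ^ n)) = (\<Sum>k<2 ^ n. (cmod (a k))\<^sup>2)"
    unfolding sum_distrib_right[symmetric] walsh_value_parseval by simp
  also have "(\<lambda>q. \<Sum>k<2 ^ n. (cmod (?v (xor k q)))\<^sup>2 * (cube_step k / 8 ^ n)) ` {..<2 ^ n}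
      = (\<lambda>k0. \<Sum>k<2 ^ n. (cmod (fast_walsh_transform n a (xor k k0)))\<^sup>2
                     * ((real k + 1) ^ 3 - real k ^ 3) / 2 ^ (2 * n) / 3) ` {..<2 ^ n}"
  proof (intro image_cong sum.cong refl)
    fix k q :: nat assume "q \<in> {..<2 ^ n}" "k \<in> {..<2 ^ n}"
    then have lt: "xor k q < 2 ^ n" by (simp add: xor_less_power)
    \<comment> \<open>The factor \<open>2 ^ n\<close> is absorbed by the normalization of the fast
      transform; \<open>2 ^ (2 * n)\<close> stays in the weight.\<close>
    have "(8::real) ^ n = 2 ^ n * 2 ^ (2 * n)"
      by (simp add: power_mult power_mult_distrib[symmetric])
    then show "(cmod (?v (xor k q)))\<^sup>2 * (cube_step k / 8 ^ n)
        = (cmod (fast_walsh_transform n a (xor k q)))\<^sup>2 * ((real k + 1) ^ 3 - real k ^ 3) / 2 ^ (2 * n) / 3"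
      by (simp add: norm_fast_walsh_transform[OF lt] cube_step_def)
  qed
  finally show ?thesis .
qed

lemma V_walsh_transform_walsh_partial:
  assumes "0 < (\<Sum>k<2 ^ n. (cmod (a k))\<^sup>2)"
  shows "V (walsh_transform (walsh_partial n a)) = ennreal
      (Min ((\<lambda>k1. \<Sum>k<2 ^ n. (cmod (a (xor k k1)))\<^sup>2
                     * ((real k + 1) ^ 3 - real k ^ 3) / 3) ` {..<2 ^ n})
       / (\<Sum>k<2 ^ n. (cmod (fast_walsh_transform n a k))\<^sup>2))"
proof -
  have "(\<Sum>k<2 ^ n. (cmod (fast_walsh_transform n a k))\<^sup>2) = (\<Sum>k<2 ^ n. (cmod (walsh_value n a k))\<^sup>2) / 2 ^ n"
    unfolding sum_divide_distrib by (intro sum.cong refl) (simp add: norm_fast_walsh_transform)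
  also have "\<dots> = (\<Sum>k<2 ^ n. (cmod (a k))\<^sup>2)"
    unfolding walsh_value_parseval by simp
  finally have norm: "(\<Sum>k<2 ^ n. (cmod (fast_walsh_transform n a k))\<^sup>2) = (\<Sum>k<2 ^ n. (cmod (a k))\<^sup>2)" .
  have "V (walsh_transform (walsh_partial n a)) = ennreal
     (Min ((\<lambda>q. \<Sum>k<2 ^ n. (cmod (a (xor k q)))\<^sup>2 * (cube_step k / 8 ^ 0)) ` {..<2 ^ n})
       / (\<Sum>k<2 ^ n. (cmod (a k))\<^sup>2 * (1 / 2 ^ 0)))"
    by (intro V_dyadic_step walsh_transform_walsh_partial assms)
  then show ?thesis by (simp add: norm cube_step_def)
qed

subsection \<open>Stability under uniform convergence\<close>

text \<open>The symmetric additive estimate avoids the truncated subtraction of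
  \<open>ennreal\<close>. As \<open>L\<close> is finite, it makes \<open>X n\<close> eventually
  finite, and the claim becomes one about reals.\<close>

lemma tendsto_ennreal_approx:
  fixes X :: "'a \<Rightarrow> ennreal"
  assumes "L < top" "\<And>e. 0 < e \<Longrightarrow> \<forall>\<^sub>F n in F. X n \<le> L + ennreal e \<and> L \<le> X n + ennreal e"
  shows "(X \<longlongrightarrow> L) F"
proof -
  obtain l where l: "L = ennreal l" "0 \<le> l" using assms(1) by (cases L) auto
  have fin: "\<exists>x\<ge>0. X n = ennreal x \<and> x \<le> l + e \<and> l \<le> x + e"
    if "X n \<le> L + ennreal e \<and> L \<le> X n + ennreal e" "0 < e" for n e
    using that l
    by (cases "X n") (auto simp: top_unique ennreal_plus[symmetric] simp del: ennreal_plus)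
  have "((\<lambda>n. enn2real (X n)) \<longlongrightarrow> l) F"
  proof (rule tendstoI)
    fix e :: real assume "0 < e"
    then have "0 < e / 2" by simp
    from assms(2)[OF this] show "\<forall>\<^sub>F n in F. dist (enn2real (X n)) l < e"
    proof eventually_elim
      case (elim n)
      from fin[OF this \<open>0 < e / 2\<close>] show ?case using \<open>0 < e\<close> by (auto simp: dist_real_def)
    qed
  qed
  then have "((\<lambda>n. ennreal (enn2real (X n))) \<longlongrightarrow> L) F"
    unfolding l by (rule tendsto_ennrealI)
  moreover have "\<forall>\<^sub>F n in F. ennreal (enn2real (X n)) = X n"
    using assms(2)[OF zero_less_one]
  proof eventually_elim
    case (elim n)
    from fin[OF this zero_less_one] show ?case by auto
  qed
  ultimately show ?thesis by (rule Lim_transform_eventually)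
qed

lemma tendsto_ennreal_enn2real:
  fixes X :: "'a \<Rightarrow> ennreal"
  assumes "(X \<longlongrightarrow> L) F" "L < top"
  shows "((\<lambda>n. enn2real (X n)) \<longlongrightarrow> enn2real L) F"
    and "\<forall>\<^sub>F n in F. X n = ennreal (enn2real (X n))"
proof -
  show ev: "\<forall>\<^sub>F n in F. X n = ennreal (enn2real (X n))"
    using order_tendstoD(2)[OF assms] by eventually_elim simp
  show "((\<lambda>n. enn2real (X n)) \<longlongrightarrow> enn2real L) F"
    using assms by (intro tendsto_enn2real) simp_all
qed

text \<open>The conditions on \<open>L\<close> and \<open>M\<close> exclude the indeterminate
  quotients and make numerator and denominator eventually real.\<close>

lemma tendsto_divide_ennreal:
  fixes X Y :: "'a \<Rightarrow> ennreal"
  assumes "(X \<longlongrightarrow> L) F" "(Y \<longlongrightarrow> M) F" "L < top" "0 < M" "M < top"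
  shows "((\<lambda>n. X n / Y n) \<longlongrightarrow> L / M) F"
proof -
  note X = tendsto_ennreal_enn2real[OF assms(1,3)] and Y = tendsto_ennreal_enn2real[OF assms(2,5)]
  have M: "0 < enn2real M" using assms by (simp add: enn2real_positive_iff)
  have "((\<lambda>n. ennreal (enn2real (X n) / enn2real (Y n))) \<longlongrightarrow> ennreal (enn2real L / enn2real M)) F"
    using M by (intro tendsto_ennrealI tendsto_divide X(1) Y(1)) simp
  moreover have "ennreal (enn2real L / enn2real M) = L / M"
    using M assms(3,5) by (simp flip: divide_ennreal)
  moreover have "\<forall>\<^sub>F n in F. ennreal (enn2real (X n) / enn2real (Y n)) = X n / Y n"
    using X(2) Y(2) order_tendstoD(1)[OF assms(2,4)]
  proof eventually_elim
    case (elim n)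
    then have "0 < enn2real (Y n)" by (metis ennreal_0 ennreal_less_zero_iff)
    then show ?case using elim by (metis divide_ennreal enn2real_nonneg)
  qed
  ultimately show ?thesis using Lim_transform_eventually by fastforce
qed

definition dyadic_moment :: "(real \<Rightarrow> complex) \<Rightarrow> real \<Rightarrow> ennreal" where
  "dyadic_moment g y = (\<integral>\<^sup>+ x. ennreal ((dyadic_sum x y)\<^sup>2 * (cmod (g x))\<^sup>2) \<partial>Rplus)"

text \<open>The numerator of \<open>V\<close>, split off so that its limit and that of the norm can
  be taken separately.\<close>

definition min_moment :: "(real \<Rightarrow> complex) \<Rightarrow> ennreal" where
  "min_moment g = (INF y\<in>{0..}. dyadic_moment g y)"

lemma V_eq_min_moment: "V g = min_moment g / sq_norm g"
  by (simp add: V_def min_moment_def dyadic_moment_def)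

lemma dyadic_sum_measurable_Rplus:
  assumes "0 \<le> y"
  shows "(\<lambda>x. dyadic_sum x y) \<in> borel_measurable Rplus"
proof -
  have "(\<lambda>x. indicator {0..} x * dyadic_sum x y) \<in> borel_measurable lebesgue"
    using dyadic_sum_measurable[OF assms] by (intro measurable_completion) simp
  then have "(\<lambda>x. indicator {0..} x * dyadic_sum x y) \<in> borel_measurable Rplus"
    by (rule measurable_restrict_space1)
  then show ?thesis by (rule measurable_cong[THEN iffD1, rotated]) simp
qed

text \<open>An error \<open>e\<close> in the squares costs at most \<open>e\<close>, because the
  support has measure 1 and the weight is at most 1 there. The weight \<open>1\<close> serves the
  norm, the squared dyadic sum serves the moment.\<close>

lemma nn_integral_weight_le:
  fixes g h :: "real \<Rightarrow> complex" and w :: "real \<Rightarrow> real"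
  assumes [measurable]: "h \<in> borel_measurable Rplus" "w \<in> borel_measurable Rplus"
    and w: "\<And>x. 0 \<le> x \<Longrightarrow> 0 \<le> w x" "\<And>x. 0 \<le> x \<Longrightarrow> x < 1 \<Longrightarrow> w x \<le> 1"
    and g: "\<And>x. x \<notin> {0..<1} \<Longrightarrow> g x = 0" "\<And>x. (cmod (g x))\<^sup>2 \<le> (cmod (h x))\<^sup>2 + e" and e: "0 \<le> e"
  shows "(\<integral>\<^sup>+x. ennreal (w x * (cmod (g x))\<^sup>2) \<partial>Rplus)
    \<le> (\<integral>\<^sup>+x. ennreal (w x * (cmod (h x))\<^sup>2) \<partial>Rplus) + ennreal e"
proof -
  have "{0..<1::real} \<in> sets Rplus" by (auto simp: sets_restrict_space_iff)
  then have [measurable]: "(\<lambda>x. ennreal e * indicator {0..<1::real} x) \<in> borel_measurable Rplus"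
    by measurable
  have "(\<integral>\<^sup>+x. ennreal (w x * (cmod (g x))\<^sup>2) \<partial>Rplus)
      \<le> (\<integral>\<^sup>+x. ennreal (w x * (cmod (h x))\<^sup>2) + ennreal e * indicator {0..<1} x \<partial>Rplus)"
  proof (rule nn_integral_mono)
    fix x :: real assume "x \<in> space Rplus"
    then have x: "0 \<le> x" by simp
    show "ennreal (w x * (cmod (g x))\<^sup>2) \<le> ennreal (w x * (cmod (h x))\<^sup>2) + ennreal e * indicator {0..<1} x"
    proof (cases "x < 1")
      case True
      have "w x * (cmod (g x))\<^sup>2 \<le> w x * (cmod (h x))\<^sup>2 + w x * e"
        using mult_left_mono[OF g(2)[of x] w(1)[OF x]] by (simp add: algebra_simps)
      also have "\<dots> \<le> w x * (cmod (h x))\<^sup>2 + e"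
        using w[OF x] True e by (simp add: mult_left_le_one_le)
      finally show ?thesis
        using True x e w(1)[OF x] by (simp add: ennreal_plus[symmetric] del: ennreal_plus)
    qed (simp add: g(1))
  qed
  also have "\<dots> = (\<integral>\<^sup>+x. ennreal (w x * (cmod (h x))\<^sup>2) \<partial>Rplus) + ennreal e * emeasure Rplus {0..<1}"
    using \<open>{0..<1} \<in> sets Rplus\<close> by (subst nn_integral_add) (auto simp: nn_integral_cmult_indicator)
  also have "emeasure Rplus {0..<1::real} = 1"
    by (subst emeasure_restrict_space) auto
  finally show ?thesis by simp
qed

text \<open>On \<open>[0,1)\<close> the weights are at most \<open>1\<close>, which makes the moments stable under uniform
  convergence.\<close>

lemma min_moment_unit_interval:
  assumes "\<And>x. x \<notin> {0..<1} \<Longrightarrow> g x = 0"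
  shows "min_moment g = (INF y\<in>{0..<1}. dyadic_moment g y)"
proof (rule antisym)
  show "min_moment g \<le> (INF y\<in>{0..<1}. dyadic_moment g y)"
    unfolding min_moment_def by (rule INF_superset_mono) auto
  have frac_le: "dyadic_moment g (frac y) \<le> dyadic_moment g y" if "0 \<le> y" for y
    unfolding dyadic_moment_def
  proof (intro nn_integral_mono ennreal_leI)
    fix x :: real assume "x \<in> space Rplus"
    then have x: "0 \<le> x" by simp
    show "(dyadic_sum x (frac y))\<^sup>2 * (cmod (g x))\<^sup>2 \<le> (dyadic_sum x y)\<^sup>2 * (cmod (g x))\<^sup>2"
    proof (cases "x < 1")
      case True
      then show ?thesis
        using x that by (intro mult_right_mono power_mono dyadic_sum_frac_le dyadic_sum_nonneg) auto
    qed (simp add: assms)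
  qed
  show "(INF y\<in>{0..<1}. dyadic_moment g y) \<le> min_moment g"
    unfolding min_moment_def
  proof (rule INF_greatest)
    fix y :: real assume "y \<in> {0..}"
    then show "(INF y\<in>{0..<1}. dyadic_moment g y) \<le> dyadic_moment g y"
      using frac_le[of y] by (intro INF_lower2[of "frac y"]) (auto simp: frac_lt_1)
  qed
qed

lemma min_moment_le:
  assumes "h \<in> borel_measurable Rplus" "\<And>x. x \<notin> {0..<1} \<Longrightarrow> g x = 0" "\<And>x. x \<notin> {0..<1} \<Longrightarrow> h x = 0"
    and "\<And>x. (cmod (g x))\<^sup>2 \<le> (cmod (h x))\<^sup>2 + e" "0 \<le> e"
  shows "min_moment g \<le> min_moment h + ennreal e"
proof -
  \<comment> \<open>With the error on the left, the right side is a lone moment, so the infimum over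
    \<open>y\<close> in \<open>[0,1)\<close> can be taken.\<close>
  have "min_moment g - ennreal e \<le> dyadic_moment h y" if y: "0 \<le> y" "y < 1" for y
  proof -
    have "min_moment g \<le> dyadic_moment g y"
      unfolding min_moment_def using y by (intro INF_lower) auto
    also have "\<dots> \<le> dyadic_moment h y + ennreal e"
      unfolding dyadic_moment_def using y
      by (intro nn_integral_weight_le assms borel_measurable_power dyadic_sum_measurable_Rplus power_le_one
          dyadic_sum_nonneg dyadic_sum_le_1) auto
    finally show ?thesis by (simp add: ennreal_minus_le_iff add.commute)
  qed
  then have "min_moment g - ennreal e \<le> min_moment h"
    by (subst min_moment_unit_interval[OF assms(3)]) (auto intro: INF_greatest)
  then show ?thesis by (simp add: ennreal_minus_le_iff add.commute)
qed

lemma sq_norm_le: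
  assumes "h \<in> borel_measurable Rplus" "\<And>x. x \<notin> {0..<1} \<Longrightarrow> g x = 0"
    and "\<And>x. (cmod (g x))\<^sup>2 \<le> (cmod (h x))\<^sup>2 + e" "0 \<le> e"
  shows "sq_norm g \<le> sq_norm h + ennreal e"
  using nn_integral_weight_le[where w = "\<lambda>_. 1", OF assms(1) _ _ _ assms(2-4)] by (simp add: sq_norm_def)

lemma uniform_limit_norm_square:
  fixes g :: "nat \<Rightarrow> real \<Rightarrow> complex"
  assumes lim: "uniform_limit UNIV g h sequentially" and bound: "\<And>x. cmod (h x) \<le> B" and e: "0 < e"
  shows "\<forall>\<^sub>F n in sequentially. \<forall>x. \<bar>(cmod (g n x))\<^sup>2 - (cmod (h x))\<^sup>2\<bar> \<le> e"
proof -
  have B: "0 \<le> B" using bound[of 0] norm_ge_zero order_trans by blast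
  \<comment> \<open>The difference of squares is a difference of norms, at most \<open>d\<close>,
    times their sum, at most \<open>2 * B + d\<close> and hence at most
    \<open>2 * B + 1\<close>.\<close>
  define d where "d = min 1 (e / (2 * B + 1))"
  have "d * (2 * B + 1) \<le> e / (2 * B + 1) * (2 * B + 1)"
    using B by (intro mult_right_mono) (simp_all add: d_def)
  then have d: "0 < d" "d \<le> 1" "d * (2 * B + 1) \<le> e"
    using e B by (simp_all add: d_def)
  from uniform_limitD[OF lim d(1)] show ?thesis
  proof eventually_elim
    case (elim n)
    show ?case
    proof
      fix x
      have c: "\<bar>cmod (g n x) - cmod (h x)\<bar> \<le> d"
        using elim norm_triangle_ineq3[of "g n x" "h x"] by (auto simp: dist_norm intro: less_imp_le le_less_trans)
      have "\<bar>(cmod (g n x))\<^sup>2 - (cmod (h x))\<^sup>2\<bar> = \<bar>cmod (g n x) - cmod (h x)\<bar> * \<bar>cmod (g n x) + cmod (h x)\<bar>"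
        by (simp only: power2_eq_square square_diff_square_factored abs_mult mult.commute)
      also have "\<dots> \<le> d * (2 * B + 1)"
        using c bound[of x] d by (intro mult_mono) auto
      finally show "\<bar>(cmod (g n x))\<^sup>2 - (cmod (h x))\<^sup>2\<bar> \<le> e" using d by linarith
    qed
  qed
qed

lemma uniform_limit_moments:
  fixes g :: "nat \<Rightarrow> real \<Rightarrow> complex"
  assumes lim: "uniform_limit UNIV g h sequentially" and bound: "\<And>x. cmod (h x) \<le> B"
    and meas: "\<And>n. g n \<in> borel_measurable Rplus" "h \<in> borel_measurable Rplus"
    and supp: "\<And>n x. x \<notin> {0..<1} \<Longrightarrow> g n x = 0" "\<And>x. x \<notin> {0..<1} \<Longrightarrow> h x = 0"
  shows "sq_norm h < top" "(\<lambda>n. sq_norm (g n)) \<longlonglongrightarrow> sq_norm h"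
    "min_moment h < top" "(\<lambda>n. min_moment (g n)) \<longlonglongrightarrow> min_moment h"
proof -
  \<comment> \<open>Comparing the bounded \<open>h\<close> with the zero function, at error
    \<open>B\<close> squared, yields finiteness of its norm and moment.\<close>
  have h0: "(cmod (h x))\<^sup>2 \<le> (cmod 0)\<^sup>2 + B\<^sup>2" for x
    using power_mono[OF bound[of x] norm_ge_zero, of 2] by simp
  have "sq_norm h \<le> sq_norm (\<lambda>_. 0) + ennreal (B\<^sup>2)"
    by (rule sq_norm_le) (use supp h0 in auto)
  also have "sq_norm (\<lambda>_. 0) = 0" by (simp add: sq_norm_def)
  finally show sq_fin: "sq_norm h < top" by (auto simp: less_top[symmetric] top_unique)
  have "min_moment h \<le> min_moment (\<lambda>_. 0) + ennreal (B\<^sup>2)"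
    by (rule min_moment_le) (use supp h0 in auto)
  also have "min_moment (\<lambda>_. 0) = 0" by (simp add: min_moment_def dyadic_moment_def)
  finally show mom_fin: "min_moment h < top" by (auto simp: less_top[symmetric] top_unique)
  have ev: "\<forall>\<^sub>F n in sequentially. \<forall>x. (cmod (g n x))\<^sup>2 \<le> (cmod (h x))\<^sup>2 + e \<and> (cmod (h x))\<^sup>2 \<le> (cmod (g n x))\<^sup>2 + e"
    if "0 < e" for e
    using uniform_limit_norm_square[OF lim bound that] by eventually_elim (auto simp: abs_le_iff algebra_simps)
  show "(\<lambda>n. sq_norm (g n)) \<longlonglongrightarrow> sq_norm h"
  proof (rule tendsto_ennreal_approx[OF sq_fin])
    fix e :: real assume "0 < e"
    from ev[OF this] show "\<forall>\<^sub>F n in sequentially. sq_norm (g n) \<le> sq_norm h + ennreal e \<and> sq_norm h \<le> sq_norm (g n) + ennreal e"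
    proof eventually_elim
      case (elim n)
      then show ?case using \<open>0 < e\<close> by (intro conjI sq_norm_le meas supp) auto
    qed
  qed
  show "(\<lambda>n. min_moment (g n)) \<longlonglongrightarrow> min_moment h"
  proof (rule tendsto_ennreal_approx[OF mom_fin])
    fix e :: real assume "0 < e"
    from ev[OF this] show "\<forall>\<^sub>F n in sequentially. min_moment (g n) \<le> min_moment h + ennreal e \<and> min_moment h \<le> min_moment (g n) + ennreal e"
    proof eventually_elim
      case (elim n)
      then show ?case using \<open>0 < e\<close> by (intro conjI min_moment_le meas supp) auto
    qed
  qed
qed

subsection \<open>Walsh series\<close>

text \<open>Passes to the subsequence of lengths \<open>2 ^ n\<close>; the limit is uniform on the
  whole line because all functions vanish off \<open>[0,1)\<close>.\<close>

lemma uniform_limit_walsh_partial: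
  assumes conv: "uniformly_convergent_on {0..<1} (\<lambda>N x. \<Sum>k<N. a k * complex_of_real (walsh (real k) x))"
    and f: "\<And>x. f x = indicator {0..<1} x * (\<Sum>k. a k * complex_of_real (walsh (real k) x))"
  shows "uniform_limit UNIV (\<lambda>n. walsh_partial n a) f sequentially"
proof -
  let ?S = "\<lambda>N x. \<Sum>k<N. a k * complex_of_real (walsh (real k) x)"
  obtain l where l: "uniform_limit {0..<1} ?S l sequentially"
    using conv by (auto simp: uniformly_convergent_on_def)
  have lf: "l x = f x" if "x \<in> {0..<1}" for x
  proof -
    have "(\<lambda>k. a k * complex_of_real (walsh (real k) x)) sums l x"
      using tendsto_uniform_limitI[OF l that] by (simp add: sums_def)
    then show ?thesis using that f[of x] by (simp add: sums_unique)
  qed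
  have "filterlim (\<lambda>n. 2 ^ n :: nat) at_top sequentially"
    by (rule filterlim_at_top_mono[OF filterlim_ident]) (auto simp: less_imp_le less_exp)
  from filterlim_compose[OF l this] have lim: "uniform_limit {0..<1} (\<lambda>n. ?S (2 ^ n)) l sequentially" .
  show ?thesis
  proof (rule uniform_limitI)
    fix e :: real assume "0 < e"
    from uniform_limitD[OF lim this]
    show "\<forall>\<^sub>F n in sequentially. \<forall>x\<in>UNIV. dist (walsh_partial n a x) (f x) < e"
    proof eventually_elim
      case (elim n)
      show ?case
      proof
        fix x :: real
        show "dist (walsh_partial n a x) (f x) < e"
        proof (cases "x \<in> {0..<1}")
          case True
          then show ?thesis using bspec[OF elim True] lf[OF True] by (simp add: walsh_partial_def)
        next
          case False
          then show ?thesis using \<open>0 < e\<close> f[of x] by (simp add: walsh_partial_def)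
        qed
      qed
    qed
  qed
qed

lemma abs_walsh: "\<bar>walsh t x\<bar> = 1"
  by (simp add: walsh_def power_abs)

lemma walsh_partial_bound: "cmod (walsh_partial n a x) \<le> (\<Sum>k<2 ^ n. cmod (a k))"
proof -
  have "cmod (\<Sum>k<2 ^ n. a k * complex_of_real (walsh (real k) x)) \<le> (\<Sum>k<2 ^ n. cmod (a k))"
    by (rule order_trans[OF norm_sum]) (simp add: norm_mult abs_walsh)
  moreover have "0 \<le> (\<Sum>k<2 ^ n. cmod (a k))" by (intro sum_nonneg) simp
  ultimately show ?thesis by (auto simp: walsh_partial_def indicator_def)
qed

lemma uniform_limit_walsh_partial_bound:
  assumes "uniform_limit UNIV (\<lambda>n. walsh_partial n a) f sequentially"
  obtains B n0 where "\<And>x. cmod (f x) \<le> B" "\<And>n x. n0 \<le> n \<Longrightarrow> cmod (walsh_partial n a x) \<le> B"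
proof -
  obtain n0 where n0: "\<And>n x. n0 \<le> n \<Longrightarrow> cmod (walsh_partial n a x - f x) < 1"
    using uniform_limitD[OF assms zero_less_one] by (auto simp: eventually_sequentially dist_norm)
  \<comment> \<open>One partial sum has a crude bound by its coefficients; uniform closeness carries
    it to \<open>f\<close> and then to all later partial sums, at a cost of 1 each time.\<close>
  define B where "B = (\<Sum>k<2 ^ n0. cmod (a k)) + 1"
  have f: "cmod (f x) \<le> B" for x
  proof -
    have "cmod (f x) \<le> cmod (walsh_partial n0 a x) + cmod (walsh_partial n0 a x - f x)"
      by (metis norm_minus_commute norm_triangle_sub)
    then show ?thesis using n0[of n0 x] walsh_partial_bound[of n0 a x] by (simp add: B_def)
  qed
  show ?thesis
  proof (rule that[of "B + 1" n0])
    show "cmod (f x) \<le> B + 1" for x using f[of x] by simp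
    show "cmod (walsh_partial n a x) \<le> B + 1" if "n0 \<le> n" for n x
      using n0[OF that, of x] f[of x] norm_triangle_sub[of "walsh_partial n a x" "f x"] by simp
  qed
qed

text \<open>For fixed \<open>t\<close> the transforms of the partial sums are eventually equal to a
  single coefficient. A common bound on \<open>[0,1)\<close> allows dominated convergence to pass
  this to \<open>f\<close>.\<close>

lemma walsh_series_transform:
  assumes lim: "uniform_limit UNIV (\<lambda>n. walsh_partial n a) f sequentially"
  shows "integrable Rplus f" "0 \<le> t \<Longrightarrow> walsh_transform f t = a (dyadic_index 0 t)"
proof -
  obtain B n0 where B: "\<And>n x. n0 \<le> n \<Longrightarrow> cmod (walsh_partial n a x) \<le> B"
    using uniform_limit_walsh_partial_bound[OF lim] by metis
  have sets: "{0..<1::real} \<in> sets Rplus" by (auto simp: sets_restrict_space_iff)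
  have "emeasure Rplus {0..<1::real} = 1" by (subst emeasure_restrict_space) auto
  then have w: "integrable Rplus (\<lambda>x. B * indicator {0..<1::real} x)"
    using sets by (intro integrable_mult_right integrable_real_indicator) simp_all
  have conv: "integrable Rplus (\<lambda>x. f x * complex_of_real (walsh t x)) \<and>
      (LINT x|Rplus. f x * complex_of_real (walsh t x)) = a (dyadic_index 0 t)" if t: "0 \<le> t" for t
  proof -
    \<comment> \<open>The shift by \<open>n0\<close> makes the bound \<open>B\<close> hold for every
      member of the sequence.\<close>
    let ?s = "\<lambda>n x. walsh_partial (n + n0) a x * complex_of_real (walsh t x)"
    have int: "has_bochner_integral Rplus (?s n)
        (if dyadic_index 0 t < 2 ^ (n + n0) then a (dyadic_index 0 t) else 0)" for n
      by (rule has_bochner_integral_walsh_partial[OF t])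
    then have s_meas: "?s n \<in> borel_measurable Rplus" for n
      unfolding has_bochner_integral_iff by (blast intro: borel_measurable_integrable)
    have ptw: "(\<lambda>n. ?s n x) \<longlonglongrightarrow> f x * complex_of_real (walsh t x)" for x
    proof -
      have "(\<lambda>n. walsh_partial n a x) \<longlonglongrightarrow> f x" by (rule tendsto_uniform_limitI[OF lim]) simp
      then show ?thesis by (intro tendsto_mult tendsto_const) (rule LIMSEQ_ignore_initial_segment)
    qed
    have meas: "(\<lambda>x. f x * complex_of_real (walsh t x)) \<in> borel_measurable Rplus"
      by (rule borel_measurable_LIMSEQ_metric[OF s_meas ptw])
    have bound: "cmod (?s n x) \<le> B * indicator {0..<1} x" for n x
      using B[of "n + n0" x] by (auto simp: norm_mult abs_walsh walsh_partial_def indicator_def)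
    have "(\<lambda>n. LINT x|Rplus. ?s n x) \<longlonglongrightarrow> (LINT x|Rplus. f x * complex_of_real (walsh t x))"
      by (rule integral_dominated_convergence[OF meas s_meas w AE_I2 AE_I2]) (rule ptw, rule bound)
    moreover have "(\<lambda>n. LINT x|Rplus. ?s n x) \<longlonglongrightarrow> a (dyadic_index 0 t)"
    proof (rule tendsto_eventually)
      obtain m where m: "dyadic_index 0 t < 2 ^ m" using less_exp by blast
      have "(LINT x|Rplus. ?s n x) = a (dyadic_index 0 t)" if "m \<le> n" for n
      proof -
        have "(2::nat) ^ m \<le> 2 ^ (n + n0)" using that by (intro power_increasing) auto
        then have "dyadic_index 0 t < 2 ^ (n + n0)" using m by linarith
        then show ?thesis using has_bochner_integral_integral_eq[OF int[of n]] by simp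
      qed
      then show "\<forall>\<^sub>F n in sequentially. (LINT x|Rplus. ?s n x) = a (dyadic_index 0 t)"
        by (auto simp: eventually_sequentially)
    qed
    ultimately have "(LINT x|Rplus. f x * complex_of_real (walsh t x)) = a (dyadic_index 0 t)"
      by (rule LIMSEQ_unique)
    moreover have "integrable Rplus (\<lambda>x. f x * complex_of_real (walsh t x))"
      by (rule integrable_dominated_convergence[OF meas s_meas w AE_I2 AE_I2]) (rule ptw, rule bound)
    ultimately show ?thesis by simp
  qed
  \<comment> \<open>At \<open>t = 0\<close> the Walsh factor is constantly 1.\<close>
  show int: "integrable Rplus f" using conv[of 0] by simp
  show "walsh_transform f t = a (dyadic_index 0 t)" if "0 \<le> t"
    using conv[OF that] int by (simp add: walsh_transform_def walsh_integral_def)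
qed

section \<open>Monotone limits on the transform side\<close>

lemma nn_integral_step_limit:
  assumes w: "w \<in> borel_measurable Rplus"
    and g: "\<And>n t. 0 \<le> t \<Longrightarrow> g n t = (if dyadic_index 0 t < 2 ^ n then a (dyadic_index 0 t) else 0)"
    and h: "\<And>t. 0 \<le> t \<Longrightarrow> h t = a (dyadic_index 0 t)"
  shows "incseq (\<lambda>n. \<integral>\<^sup>+t. ennreal (w t * (cmod (g n t))\<^sup>2) \<partial>Rplus)" 
    "(\<lambda>n. \<integral>\<^sup>+t. ennreal (w t * (cmod (g n t))\<^sup>2) \<partial>Rplus) \<longlonglongrightarrow> (\<integral>\<^sup>+t. ennreal (w t * (cmod (h t))\<^sup>2) \<partial>Rplus)"
proof -
  let ?g = "\<lambda>n t. ennreal (w t * (cmod (if dyadic_index 0 t < 2 ^ n then a (dyadic_index 0 t) else 0))\<^sup>2)"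
  let ?h = "\<lambda>t. ennreal (w t * (cmod (a (dyadic_index 0 t)))\<^sup>2)"
  \<comment> \<open>Raising \<open>n\<close> only switches on further cells and leaves the earlier
    values unchanged, so monotone convergence applies for any weight.\<close>
  have inc: "incseq ?g"
  proof (rule incseq_SucI, rule le_funI)
    fix n t
    show "?g n t \<le> ?g (Suc n) t" by auto
  qed
  have idx: "dyadic_index 0 \<in> Rplus \<rightarrow>\<^sub>M count_space UNIV"
    by (intro measurable_restrict_space1 measurable_completion) simp
  have meas: "?g n \<in> borel_measurable Rplus" for n
    using w measurable_compose[OF idx, of "\<lambda>k. (cmod (if k < 2 ^ n then a k else 0))\<^sup>2" borel] by measurable
  have ptw: "(\<lambda>n. ?g n t) \<longlonglongrightarrow> ?h t" for t
  proof (rule tendsto_eventually)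
    obtain m where m: "dyadic_index 0 t < 2 ^ m" using less_exp by blast
    have "dyadic_index 0 t < 2 ^ n" if "m \<le> n" for n
      using m power_increasing[OF that, of "2::nat"] by linarith
    then show "\<forall>\<^sub>F n in sequentially. ?g n t = ?h t" by (auto simp: eventually_sequentially)
  qed
  have eg: "(\<integral>\<^sup>+t. ennreal (w t * (cmod (g n t))\<^sup>2) \<partial>Rplus) = integral\<^sup>N Rplus (?g n)" for n
    by (intro nn_integral_cong) (simp add: g)
  have eh: "(\<integral>\<^sup>+t. ennreal (w t * (cmod (h t))\<^sup>2) \<partial>Rplus) = integral\<^sup>N Rplus ?h"
    by (intro nn_integral_cong) (simp add: h)
  show "incseq (\<lambda>n. \<integral>\<^sup>+t. ennreal (w t * (cmod (g n t))\<^sup>2) \<partial>Rplus)"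
    unfolding eg using inc by (auto simp: mono_def le_fun_def intro!: nn_integral_mono)
  show "(\<lambda>n. \<integral>\<^sup>+t. ennreal (w t * (cmod (g n t))\<^sup>2) \<partial>Rplus) \<longlonglongrightarrow> (\<integral>\<^sup>+t. ennreal (w t * (cmod (h t))\<^sup>2) \<partial>Rplus)"
    unfolding eg eh by (rule nn_integral_LIMSEQ[OF inc meas ptw])
qed

text \<open>A number \<open>k < 2 ^ m\<close> can alter only the low \<open>m\<close> bits of
  \<open>q\<close>, and these contribute less than \<open>2 ^ m\<close>. This makes a moment about a
  far point large.\<close>

lemma diff_power_le_xor:
  fixes k q :: nat
  assumes "k < 2 ^ m"
  shows "q - 2 ^ m \<le> xor k q"
proof -
  have "xor k q div 2 ^ m = q div 2 ^ m"
    using assms by (simp add: drop_bit_xor flip: drop_bit_eq_div) (simp add: drop_bit_eq_div)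
  then have "q div 2 ^ m * 2 ^ m \<le> xor k q" by (metis div_times_less_eq_dividend)
  moreover have "q = q div 2 ^ m * 2 ^ m + q mod 2 ^ m" by (simp only: div_mult_mod_eq)
  moreover have "q mod 2 ^ m < 2 ^ m" by simp
  ultimately show ?thesis by linarith
qed

text \<open>The infimum commutes with the increasing limit because the moments of \<open>g n\<close> about \<open>y\<close> are,
  uniformly in \<open>n\<close>, large for large \<open>y\<close>: only finitely many integer parts of \<open>y\<close> matter.\<close>

lemma min_moment_step_limit:
  assumes g: "\<And>n t. 0 \<le> t \<Longrightarrow> g n t = (if dyadic_index 0 t < 2 ^ n then a (dyadic_index 0 t) else 0)"
    and h: "\<And>t. 0 \<le> t \<Longrightarrow> h t = a (dyadic_index 0 t)"
    and nz: "a k \<noteq> 0"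
  shows "(\<lambda>n. min_moment (g n)) \<longlonglongrightarrow> min_moment h"
proof -
  define P where "P n q = (\<Sum>k<2 ^ n. (cmod (a k))\<^sup>2 * cube_step (xor k q))" for n q
  have step: "dyadic_moment (g n) y = ennreal (P n (dyadic_index 0 y))" if "0 \<le> y" for n y
    using dyadic_step_moment[where g = "g n" and v = a and n = 0 and M = "2 ^ n", OF g that]
    by (simp add: dyadic_moment_def P_def)
  have lim: "(\<lambda>n. dyadic_moment (g n) y) \<longlonglongrightarrow> dyadic_moment h y" 
    and mono: "incseq (\<lambda>n. dyadic_moment (g n) y)" if "0 \<le> y" for y
    unfolding dyadic_moment_def
    by (rule nn_integral_step_limit[OF borel_measurable_power[OF dyadic_sum_measurable_Rplus[OF that]] g h]; assumption)+
  obtain m where m: "k < 2 ^ m" using less_exp by blast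
  have a0: "0 < (cmod (a k))\<^sup>2" using nz by simp
  have P_ge: "(cmod (a k))\<^sup>2 * real (q - 2 ^ m) \<le> P n q" if "m \<le> n" for n q
  proof -
    have "k < 2 ^ n" using m power_increasing[OF that, of "2::nat"] by linarith
    have "real (q - 2 ^ m) \<le> real (xor k q)" using diff_power_le_xor[OF m] by (simp only: of_nat_le_iff)
    also have "\<dots> \<le> cube_step (xor k q)" by (simp add: cube_step_eq)
    finally have "(cmod (a k))\<^sup>2 * real (q - 2 ^ m) \<le> (cmod (a k))\<^sup>2 * cube_step (xor k q)"
      by (rule mult_left_mono) simp
    also have "\<dots> \<le> P n q"
      unfolding P_def using \<open>k < 2 ^ n\<close> 
      by (intro member_le_sum[where f = "\<lambda>k. (cmod (a k))\<^sup>2 * cube_step (xor k q)"]) (auto simp: cube_step_nonneg)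
    finally show ?thesis .
  qed
  show ?thesis
  proof (rule order_tendstoI)
    fix c assume "min_moment h < c"
    moreover have "min_moment (g n) \<le> min_moment h" for n
      unfolding min_moment_def
      by (rule INF_mono) (auto intro!: incseq_le[OF mono lim])
    ultimately show "\<forall>\<^sub>F n in sequentially. min_moment (g n) < c"
      by (intro always_eventually allI) (rule le_less_trans)
  next
    fix c assume "c < min_moment h"
    then obtain d where d: "c < d" "d < min_moment h" using dense by blast
    then have "d < top" using less_le_trans top_greatest by blast
    then obtain d' where d': "d = ennreal d'" "0 \<le> d'" by (cases d) auto
    \<comment> \<open>From the integer part \<open>2 ^ m + K'\<close> on, the term of the one
      nonzero coefficient \<open>a k\<close> already exceeds or equals \<open>d'\<close>. The
      strictness lost here is recovered from \<open>c < d\<close>.\<close>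
    obtain K' :: nat where K': "d' / (cmod (a k))\<^sup>2 \<le> real K'" using real_arch_simple by blast
    have large: "d \<le> ennreal (P n q)" if "2 ^ m + K' \<le> q" "m \<le> n" for n q
    proof -
      have "d' \<le> (cmod (a k))\<^sup>2 * real K'" using K' a0 by (simp add: field_simps)
      also have "\<dots> \<le> (cmod (a k))\<^sup>2 * real (q - 2 ^ m)"
      proof (rule mult_left_mono)
        have "K' \<le> q - 2 ^ m" using that(1) by linarith
        then show "real K' \<le> real (q - 2 ^ m)" by (simp only: of_nat_le_iff)
      qed simp
      also have "\<dots> \<le> P n q" by (rule P_ge[OF that(2)])
      finally show ?thesis unfolding d' by (rule ennreal_leI)
    qed
    have small: "\<forall>\<^sub>F n in sequentially. \<forall>q\<in>{..<2 ^ m + K'}. d < ennreal (P n q)"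
    proof (intro eventually_ball_finite ballI)
      fix q :: nat
      have "d < dyadic_moment h (real q)"
        by (rule less_le_trans[OF d(2)]) (simp add: min_moment_def INF_lower)
      from order_tendstoD(1)[OF lim this] show "\<forall>\<^sub>F n in sequentially. d < ennreal (P n q)"
        by (simp add: step)
    qed simp
    show "\<forall>\<^sub>F n in sequentially. c < min_moment (g n)"
      using small eventually_ge_at_top[of m]
    proof eventually_elim
      case (elim n)
      have "d \<le> ennreal (P n q)" for q
        using elim large[of q n] by (cases "q < 2 ^ m + K'") (auto simp: less_imp_le)
      then have "d \<le> min_moment (g n)"
        unfolding min_moment_def by (intro INF_greatest) (simp add: step)
      then show ?case using d(1) by (rule less_le_trans[rotated])
    qed
  qed
qed

theorem lemma1:
  fixes a :: "nat \<Rightarrow> complex"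
    and f :: "real \<Rightarrow> complex"
    and fn :: "nat \<Rightarrow> real \<Rightarrow> complex"
    and c :: "nat \<Rightarrow> nat \<Rightarrow> complex"
  assumes "uniformly_convergent_on {0..<1}
             (\<lambda>N x. \<Sum>k<N. a k * complex_of_real (walsh (real k) x))"
    and "\<And>x. f x = indicator {0..<1} x * (\<Sum>k. a k * complex_of_real (walsh (real k) x))"
    and "\<And>n x. fn n x = indicator {0..<1} x * (\<Sum>k<2 ^ n. a k * complex_of_real (walsh (real k) x))"
    and "\<And>n. c n = fast_walsh_transform n a"
    and "f \<noteq> (\<lambda>x. 0)"
    and "V f < \<infinity>"
    and "V (walsh_transform f) < \<infinity>"
  shows "(\<lambda>n. V (fn n) * V (walsh_transform (fn n))) \<longlonglongrightarrow> UC_d f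
    \<and> (\<forall>\<^sub>F n in sequentially. fn n \<noteq> (\<lambda>x. 0))
    \<and> (\<forall>n. fn n \<noteq> (\<lambda>x. 0) \<longrightarrow>
         V (fn n) = ennreal
           (Min ((\<lambda>k0. \<Sum>k<2 ^ n. (cmod (c n (xor k k0)))\<^sup>2
                          * ((real k + 1) ^ 3 - real k ^ 3) / 2 ^ (2 * n) / 3) ` {..<2 ^ n})
            / (\<Sum>k<2 ^ n. (cmod (a k))\<^sup>2))
       \<and> V (walsh_transform (fn n)) = ennreal
           (Min ((\<lambda>k1. \<Sum>k<2 ^ n. (cmod (a (xor k k1)))\<^sup>2
                          * ((real k + 1) ^ 3 - real k ^ 3) / 3) ` {..<2 ^ n})
            / (\<Sum>k<2 ^ n. (cmod (c n k))\<^sup>2)))"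
proof (intro conjI allI impI)
  have fn: "fn n = walsh_partial n a" for n
    using assms(3) by (auto simp: walsh_partial_def)
  have lim: "uniform_limit UNIV (\<lambda>n. walsh_partial n a) f sequentially"
    by (rule uniform_limit_walsh_partial[OF assms(1,2)])
  have sq: "sq_norm (fn n) = ennreal (\<Sum>k<2 ^ n. (cmod (a k))\<^sup>2)" for n
  proof -
    have "sq_norm (fn n) = ennreal (\<Sum>k<2 ^ n. (cmod (walsh_value n a k))\<^sup>2 * (1 / 2 ^ n))"
      unfolding fn by (rule dyadic_step_sq_norm[OF walsh_partial_step])
    then show ?thesis
      unfolding sum_distrib_right[symmetric] walsh_value_parseval by simp
  qed
  have sq_hat: "sq_norm (walsh_transform (fn n)) = ennreal (\<Sum>k<2 ^ n. (cmod (a k))\<^sup>2)" for n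
  proof -
    have "sq_norm (walsh_transform (fn n)) = ennreal (\<Sum>k<2 ^ n. (cmod (a k))\<^sup>2 * (1 / 2 ^ 0))"
      unfolding fn by (rule dyadic_step_sq_norm[OF walsh_transform_walsh_partial])
    then show ?thesis by simp
  qed
  obtain k where k: "a k \<noteq> 0"
  proof (rule ccontr)
    assume "\<not> thesis"
    then have "a k = 0" for k using that by blast
    then have "f x = 0" for x by (simp add: assms(2))
    then show False using assms(5) by auto
  qed
  obtain m where m: "k < 2 ^ m" using less_exp by blast
  have ge: "(cmod (a k))\<^sup>2 \<le> (\<Sum>k<2 ^ n. (cmod (a k))\<^sup>2)" if "m \<le> n" for n
  proof -
    have "k < 2 ^ n" using m power_increasing[OF that, of "2::nat"] by linarith
    then show ?thesis by (intro member_le_sum) auto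
  qed
  \<comment> \<open>A single nonzero coefficient bounds the norms from below independently of
    \<open>n\<close>; the bound survives in the limit and keeps the denominators positive.\<close>
  have sq_ge: "ennreal ((cmod (a k))\<^sup>2) \<le> sq_norm (fn n)" if "m \<le> n" for n
    unfolding sq by (intro ennreal_leI ge that)
  obtain B n0 where "\<And>x. cmod (f x) \<le> B" "\<And>n x. n0 \<le> n \<Longrightarrow> cmod (walsh_partial n a x) \<le> B"
    using uniform_limit_walsh_partial_bound[OF lim] by metis
  then have fB: "cmod (f x) \<le> B" for x by blast
  have moments: "sq_norm f < top" "(\<lambda>n. sq_norm (fn n)) \<longlonglongrightarrow> sq_norm f"
    "min_moment f < top" "(\<lambda>n. min_moment (fn n)) \<longlonglongrightarrow> min_moment f"
    unfolding fn
    by (rule uniform_limit_moments[OF lim fB borel_measurable_integrable[OF integrable_walsh_partial]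
          borel_measurable_integrable[OF walsh_series_transform(1)[OF lim]]],
        (simp_all add: walsh_partial_def assms(2))[2])+
  have pos: "0 < sq_norm f"
  proof -
    have "ennreal ((cmod (a k))\<^sup>2) \<le> sq_norm f"
      by (rule LIMSEQ_le_const[OF moments(2)]) (use sq_ge in blast)
    moreover have "0 < ennreal ((cmod (a k))\<^sup>2)" using k by simp
    ultimately show ?thesis by (rule less_le_trans[rotated])
  qed
  let ?fh = "\<lambda>n. walsh_transform (walsh_partial n a)"
  note step = walsh_transform_walsh_partial[of _ _ a] walsh_series_transform(2)[OF lim]
  have "(\<lambda>n. sq_norm (?fh n)) \<longlonglongrightarrow> sq_norm (walsh_transform f)"
    using nn_integral_step_limit(2)[where w = "\<lambda>_. 1", OF _ step] by (simp add: sq_norm_def)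
  then have "(\<lambda>n. sq_norm (fn n)) \<longlonglongrightarrow> sq_norm (walsh_transform f)"
    by (simp add: sq sq_hat flip: fn)
  \<comment> \<open>The norms of the partial sums tend to both sides: by uniform convergence to the
    one, by monotone convergence of the transforms to the other.\<close>
  then have sq_eq: "sq_norm (walsh_transform f) = sq_norm f"
    using moments(2) by (rule LIMSEQ_unique)
  have sq_lim: "(\<lambda>n. sq_norm (walsh_transform (fn n))) \<longlonglongrightarrow> sq_norm (walsh_transform f)"
    using moments(2) by (simp add: sq_eq sq sq_hat)
  have mom_lim: "(\<lambda>n. min_moment (walsh_transform (fn n))) \<longlonglongrightarrow> min_moment (walsh_transform f)"
    unfolding fn by (rule min_moment_step_limit[OF step k])
  \<comment> \<open>With a finite denominator, an infinite numerator would make the quotient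
    infinite.\<close>
  have "min_moment (walsh_transform f) < top"
    using assms(7) moments(1)
    by (auto simp: V_eq_min_moment sq_eq less_top[symmetric] ennreal_divide_eq_top_iff)
  then have "(\<lambda>n. V (walsh_transform (fn n))) \<longlonglongrightarrow> V (walsh_transform f)"
    unfolding V_eq_min_moment using pos moments(1)
    by (intro tendsto_divide_ennreal mom_lim sq_lim) (simp_all add: sq_eq)
  moreover have "(\<lambda>n. V (fn n)) \<longlonglongrightarrow> V f"
    unfolding V_eq_min_moment by (intro tendsto_divide_ennreal moments pos)
  \<comment> \<open>Both limits are finite, so the product stays away from zero times infinity,
    where multiplication is discontinuous.\<close>
  ultimately show "(\<lambda>n. V (fn n) * V (walsh_transform (fn n))) \<longlonglongrightarrow> UC_d f"
    unfolding UC_d_def using assms(6,7) by (intro tendsto_mult_ennreal) auto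
  show "\<forall>\<^sub>F n in sequentially. fn n \<noteq> (\<lambda>x. 0)"
    unfolding eventually_sequentially
  proof (intro exI allI impI notI)
    fix n assume "m \<le> n" "fn n = (\<lambda>x. 0)"
    then show False using sq_ge[of n] k by (simp add: sq_norm_def)
  qed
  fix n assume "fn n \<noteq> (\<lambda>x. 0)"
  have pos_n: "0 < (\<Sum>k<2 ^ n. (cmod (a k))\<^sup>2)"
  proof (rule ccontr)
    assume "\<not> ?thesis"
    then have "(\<Sum>k<2 ^ n. (cmod (a k))\<^sup>2) = 0"
      by (meson antisym not_less sum_nonneg zero_le_power2)
    then have "a k = 0" if "k < 2 ^ n" for k
      using that by (simp add: sum_nonneg_eq_0_iff)
    then have "fn n = (\<lambda>x. 0)" by (simp add: assms(3) fun_eq_iff)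
    then show False using \<open>fn n \<noteq> (\<lambda>x. 0)\<close> by contradiction
  qed
  show "V (fn n) = ennreal
           (Min ((\<lambda>k0. \<Sum>k<2 ^ n. (cmod (c n (xor k k0)))\<^sup>2
                          * ((real k + 1) ^ 3 - real k ^ 3) / 2 ^ (2 * n) / 3) ` {..<2 ^ n})
            / (\<Sum>k<2 ^ n. (cmod (a k))\<^sup>2))"
    unfolding fn assms(4) by (rule V_walsh_partial[OF pos_n])
  show "V (walsh_transform (fn n)) = ennreal
           (Min ((\<lambda>k1. \<Sum>k<2 ^ n. (cmod (a (xor k k1)))\<^sup>2
                          * ((real k + 1) ^ 3 - real k ^ 3) / 3) ` {..<2 ^ n})
            / (\<Sum>k<2 ^ n. (cmod (c n k))\<^sup>2))"
    unfolding fn assms(4) by (rule V_walsh_transform_walsh_partial[OF pos_n])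
qed

end
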